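(* Let $X$ be an irreducible $1$-step shift of finite type and $\pi:X\to Y$ a finite-to-one $1$-block factor code of degree $d$. Let $\Lambda$ be the topological degree joining for $\pi$ and let $\pi_\Lambda:\Lambda\to Y$ be given by $\pi_\Lambda=\pi\circ p_1=\cdots=\pi\circ p_d$. Then for each fully supported $\nu\in E(Y)$, the quadruple $(X,Y,\pi,\nu)$ is a factor quadruple with degree $d$, and the set of all degree joinings over $\nu$ with respect to $\pi$ is $$\{\lambda\in E(\Lambda):\pi_\Lambda\lambda=\nu\}.$$
   Context: Shift spaces are two-sided over finite alphabets, with shift map $\sigma$; a shift space is irreducible if it has a point with dense forward orbit. A factor code $\pi:X\to Y$ is a continuous shift-commuting surjection between shift spaces; it is $1$-block if $\pi(x)_i=\Phi(x_i)$ for a symbol map $\Phi$. A $1$-step shift of finite type is one defined by forbidding a set of words of length $2$. A factor code on an irreducible sofic shift is finite-to-one if every fiber $\pi^{-1}(y)$ is finite; its degree is the unique $d\in\mathbb N$ such that every doubly transitive point $y\in Y$ (forward and backward orbits both dense) has exactly $d$ preimages. Two points $x,x'$ of a $1$-step SFT are mutually separated if $x_i\ne x'_i$ for all $i\in\mathbb Z$; a set of points is mutually separated if each pair of its points is. $p_i:X^n\to X$ denotes the $i$-th coordinate projection and $X^n_\pi=\{(x^{(1)},\dots,x^{(n)})\in X^n:\pi(x^{(1)})=\cdots=\pi(x^{(n)})\}$. The topological degree joining for $\pi$ is the set $\Lambda$ of all $(x^{(1)},\dots,x^{(d)})\in X^d_\pi$ such that $x^{(1)},\dots,x^{(d)}$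 are $d$ distinct mutually separated points; it is a subsystem of $X^d$ under the product shift. Measures are Borel probability measures; $E(\cdot)$ denotes the set of ergodic shift-invariant measures; measures on $X^d$ giving full mass to $\Lambda$ are identified with measures on $\Lambda$; pushforwards are written $\pi\mu$. $\nu$ is fully supported if its topological support is $Y$. $(X,Y,\pi,\nu)$ is a factor quadruple if $\pi:X\to Y$ is a factor map of topological dynamical systems (homeomorphisms of compact metric spaces) and $\nu\in E(Y)$; its degree $d_{\pi,\nu}$ is the $\nu$-a.e. constant value of $y\mapsto|\pi^{-1}(y)|$. When $d_{\pi,\nu}=d<\infty$, a degree joining over $\nu$ with respect to $\pi$ is an ergodic invariant measure $\lambda$ on $X^d$ with $\lambda(X^d_\pi)=1$, $\pi p_i\lambda=\nu$ for all $i$, and such that for $\lambda$-a.e. $(x^{(1)},\dots,x^{(d)})$ the points $x^{(1)},\dots,x^{(d)}$ are pairwise distinct. *)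

theory Defs
  imports "HOL-Probability.Probability" "HOL-Library.Extended_Nat"
begin

section \<open>Shift spaces\<close>

definition full_shift_top :: "(int \<Rightarrow> 'a) topology" where
  "full_shift_top = product_topology (\<lambda>_. discrete_topology UNIV) UNIV"

definition shift_map :: "(int \<Rightarrow> 'a) \<Rightarrow> (int \<Rightarrow> 'a)" where
  "shift_map x = (\<lambda>i. x (i + 1))"

definition shift_space :: "(int \<Rightarrow> 'a::finite) set \<Rightarrow> bool" where
  "shift_space X \<longleftrightarrow> closedin full_shift_top X \<and> shift_map ` X = X"

definition shift_top :: "(int \<Rightarrow> 'a) set \<Rightarrow> (int \<Rightarrow> 'a) topology" where
  "shift_top X = subtopology full_shift_top X"

definition forward_orbit :: "(int \<Rightarrow> 'a) \<Rightarrow> (int \<Rightarrow> 'a) set" where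
  "forward_orbit x = {(shift_map ^^ n) x | n. True}"

definition backward_orbit :: "(int \<Rightarrow> 'a) \<Rightarrow> (int \<Rightarrow> 'a) set" where
  "backward_orbit x = {(inv shift_map ^^ n) x | n. True}"

definition dense_in_shift :: "(int \<Rightarrow> 'a) set \<Rightarrow> (int \<Rightarrow> 'a) set \<Rightarrow> bool" where
  "dense_in_shift X D \<longleftrightarrow> shift_top X closure_of D = X"

definition irreducible_shift :: "(int \<Rightarrow> 'a::finite) set \<Rightarrow> bool" where
  "irreducible_shift X \<longleftrightarrow> shift_space X \<and> (\<exists>x\<in>X. dense_in_shift X (forward_orbit x))"

definition doubly_transitive :: "(int \<Rightarrow> 'a) set \<Rightarrow> (int \<Rightarrow> 'a) \<Rightarrow> bool" where
  "doubly_transitive Y y \<longleftrightarrow> y \<in> Y \<and> dense_in_shift Y (forward_orbit y)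
     \<and> dense_in_shift Y (backward_orbit y)"

definition occurs_in :: "'a list \<Rightarrow> (int \<Rightarrow> 'a) \<Rightarrow> bool" where
  "occurs_in w x \<longleftrightarrow> (\<exists>i. \<forall>k<length w. x (i + int k) = w ! k)"

definition forbid :: "'a list set \<Rightarrow> (int \<Rightarrow> 'a) set" where
  "forbid F = {x. \<forall>w\<in>F. \<not> occurs_in w x}"

definition one_step_SFT :: "(int \<Rightarrow> 'a::finite) set \<Rightarrow> bool" where
  "one_step_SFT X \<longleftrightarrow> (\<exists>F. (\<forall>w\<in>F. length w = 2) \<and> X = forbid F)"


section \<open>Factor codes\<close>

definition fiber :: "'x set \<Rightarrow> ('x \<Rightarrow> 'y) \<Rightarrow> 'y \<Rightarrow> 'x set" where
  "fiber X \<pi> y = {x \<in> X. \<pi> x = y}"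

text \<open>Maps between spaces are total functions of which only the values on the domain matter.\<close>

definition factor_code ::
    "(int \<Rightarrow> 'a::finite) set \<Rightarrow> (int \<Rightarrow> 'b::finite) set \<Rightarrow> ((int \<Rightarrow> 'a) \<Rightarrow> (int \<Rightarrow> 'b)) \<Rightarrow> bool" where
  "factor_code X Y \<pi> \<longleftrightarrow> shift_space X \<and> shift_space Y
     \<and> continuous_map (shift_top X) (shift_top Y) \<pi>
     \<and> \<pi> ` X = Y \<and> (\<forall>x\<in>X. \<pi> (shift_map x) = shift_map (\<pi> x))"

definition one_block :: "(int \<Rightarrow> 'a) set \<Rightarrow> ((int \<Rightarrow> 'a) \<Rightarrow> (int \<Rightarrow> 'b)) \<Rightarrow> bool" where
  "one_block X \<pi> \<longleftrightarrow> (\<exists>\<Phi>. \<forall>x\<in>X. \<forall>i. \<pi> x i = \<Phi> (x i))"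

definition finite_to_one :: "'x set \<Rightarrow> 'y set \<Rightarrow> ('x \<Rightarrow> 'y) \<Rightarrow> bool" where
  "finite_to_one X Y \<pi> \<longleftrightarrow> (\<forall>y\<in>Y. finite (fiber X \<pi> y))"

definition code_degree ::
    "(int \<Rightarrow> 'a) set \<Rightarrow> (int \<Rightarrow> 'b) set \<Rightarrow> ((int \<Rightarrow> 'a) \<Rightarrow> (int \<Rightarrow> 'b)) \<Rightarrow> nat" where
  "code_degree X Y \<pi> = (THE d. \<forall>y. doubly_transitive Y y \<longrightarrow>
     finite (fiber X \<pi> y) \<and> card (fiber X \<pi> y) = d)"


section \<open>Powers and the topological degree joining\<close>

text \<open>The power \<open>X\<^sup>n\<close> consists of extensional functions on the index set \<open>{1..n}\<close>, so that the
  \<open>i\<close>-th coordinate projection is evaluation at \<open>i\<close>.\<close>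

definition power_top :: "nat \<Rightarrow> 'x topology \<Rightarrow> (nat \<Rightarrow> 'x) topology" where
  "power_top n T = product_topology (\<lambda>_. T) {1..n}"

definition power_map :: "nat \<Rightarrow> ('x \<Rightarrow> 'x) \<Rightarrow> (nat \<Rightarrow> 'x) \<Rightarrow> (nat \<Rightarrow> 'x)" where
  "power_map n f z = (\<lambda>i\<in>{1..n}. f (z i))"

definition fiber_power :: "nat \<Rightarrow> 'x set \<Rightarrow> ('x \<Rightarrow> 'y) \<Rightarrow> (nat \<Rightarrow> 'x) set" where
  "fiber_power n X \<pi> =
     {z \<in> ({1..n} \<rightarrow>\<^sub>E X). \<forall>i\<in>{1..n}. \<forall>j\<in>{1..n}. \<pi> (z i) = \<pi> (z j)}"

definition mutually_separated :: "(int \<Rightarrow> 'a) \<Rightarrow> (int \<Rightarrow> 'a) \<Rightarrow> bool" where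
  "mutually_separated x x' \<longleftrightarrow> (\<forall>i. x i \<noteq> x' i)"

definition topological_degree_joining ::
    "(int \<Rightarrow> 'a) set \<Rightarrow> (int \<Rightarrow> 'b) set \<Rightarrow> ((int \<Rightarrow> 'a) \<Rightarrow> (int \<Rightarrow> 'b)) \<Rightarrow> (nat \<Rightarrow> int \<Rightarrow> 'a) set" where
  "topological_degree_joining X Y \<pi> = (let d = code_degree X Y \<pi> in
     {z \<in> fiber_power d X \<pi>. inj_on z {1..d} \<and> pairwise mutually_separated (z ` {1..d})})"


section \<open>Invariant measures\<close>

definition borel_of :: "'x topology \<Rightarrow> 'x measure" where
  "borel_of T = sigma (topspace T) {U. openin T U}"

definition ergodic_measures :: "'x topology \<Rightarrow> ('x \<Rightarrow> 'x) \<Rightarrow> 'x measure set" where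
  "ergodic_measures T f = {\<mu>. prob_space \<mu> \<and> sets \<mu> = sets (borel_of T)
     \<and> f \<in> measurable \<mu> \<mu> \<and> distr \<mu> \<mu> f = \<mu>
     \<and> (\<forall>A\<in>sets \<mu>. f -` A \<inter> space \<mu> = A \<longrightarrow> measure \<mu> A = 0 \<or> measure \<mu> A = 1)}"

definition topological_support :: "'x topology \<Rightarrow> 'x measure \<Rightarrow> 'x set" where
  "topological_support T \<mu> = {x \<in> topspace T. \<forall>U. openin T U \<and> x \<in> U \<longrightarrow> emeasure \<mu> U > 0}"

definition fully_supported :: "'x topology \<Rightarrow> 'x measure \<Rightarrow> bool" where
  "fully_supported T \<mu> \<longleftrightarrow> topological_support T \<mu> = topspace T"


section \<open>Factor quadruples and degree joinings\<close>

definition dynamical_system :: "'x topology \<Rightarrow> ('x \<Rightarrow> 'x) \<Rightarrow> bool" where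
  "dynamical_system T f \<longleftrightarrow> compact_space T \<and> metrizable_space T \<and> homeomorphic_map T T f"

definition factor_quadruple ::
    "'x topology \<Rightarrow> ('x \<Rightarrow> 'x) \<Rightarrow> 'y topology \<Rightarrow> ('y \<Rightarrow> 'y) \<Rightarrow> ('x \<Rightarrow> 'y) \<Rightarrow> 'y measure \<Rightarrow> bool" where
  "factor_quadruple T f S g \<pi> \<nu> \<longleftrightarrow> dynamical_system T f \<and> dynamical_system S g
     \<and> continuous_map T S \<pi> \<and> \<pi> ` topspace T = topspace S
     \<and> (\<forall>x\<in>topspace T. \<pi> (f x) = g (\<pi> x))
     \<and> \<nu> \<in> ergodic_measures S g"

definition ecard :: "'x set \<Rightarrow> enat" where
  "ecard A = (if finite A then enat (card A) else \<infinity>)"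

definition quadruple_degree :: "'x topology \<Rightarrow> ('x \<Rightarrow> 'y) \<Rightarrow> 'y measure \<Rightarrow> enat" where
  "quadruple_degree T \<pi> \<nu> = (THE c. AE y in \<nu>. ecard (fiber (topspace T) \<pi> y) = c)"

definition degree_joinings ::
    "'x topology \<Rightarrow> ('x \<Rightarrow> 'x) \<Rightarrow> 'y topology \<Rightarrow> ('x \<Rightarrow> 'y) \<Rightarrow> 'y measure \<Rightarrow> (nat \<Rightarrow> 'x) measure set" where
  "degree_joinings T f S \<pi> \<nu> = {\<mu>. \<exists>d. quadruple_degree T \<pi> \<nu> = enat d
     \<and> \<mu> \<in> ergodic_measures (power_top d T) (power_map d f)
     \<and> emeasure \<mu> (fiber_power d (topspace T) \<pi>) = 1
     \<and> (\<forall>i\<in>{1..d}. distr (distr \<mu> (borel_of T) (\<lambda>z. z i)) (borel_of S) \<pi> = \<nu>)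
     \<and> (AE z in \<mu>. inj_on z {1..d})}"

text \<open>A measure on a subset \<open>L\<close> of \<open>T\<close> is identified with its pushforward under the
  inclusion map, which is a measure on \<open>T\<close> giving full mass to \<open>L\<close>.\<close>

definition push_inclusion :: "'x topology \<Rightarrow> 'x measure \<Rightarrow> 'x measure" where
  "push_inclusion T \<mu> = distr \<mu> (borel_of T) (\<lambda>x. x)"

end

theory Submission
  imports Defs
begin

text \<open>For \<open>y \<in> Y\<close> and an integer \<open>p\<close>, let \<open>S\<^sub>p(y)\<close> be the set of symbols that the preimages of \<open>y\<close>
  show at \<open>p\<close>; by compactness it is controlled by a finite window of \<open>y\<close>. If \<open>y\<close> is doubly
  transitive and \<open>S\<^sub>p(y)\<close> has minimal cardinality, then two distinct preimages cannot agree at \<open>p\<close>: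
  otherwise recurrence of the window would produce infinitely many points in a finite fiber.
  Hence the fiber has exactly as many points as \<open>S\<^sub>p(y)\<close>, for every \<open>p\<close>, and its points are mutually
  separated; density of orbits makes this number independent of \<open>y\<close>. For a fully supported
  ergodic measure almost every point is doubly transitive, so a degree joining lives on the Borel
  set \<open>\<Lambda>\<close>, and restriction to \<open>\<Lambda>\<close> is inverse to pushing forward along the inclusion.\<close>

section \<open>Topology of shift spaces\<close>

lemma topspace_full_shift_top [simp]: "topspace full_shift_top = UNIV"
  by (simp add: full_shift_top_def)

lemma topspace_shift_top [simp]: "topspace (shift_top X) = X"
  by (simp add: shift_top_def)

lemma compact_space_shift_top:
  fixes X :: "(int \<Rightarrow> 'a::finite) set"
  assumes "shift_space X"
  shows "compact_space (shift_top X)"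
proof -
  have "compact_space (full_shift_top :: (int \<Rightarrow> 'a) topology)"
    unfolding full_shift_top_def
    by (auto simp: compact_space_product_topology compact_space_discrete_topology)
  then show ?thesis
    using assms closedin_compact_space compact_space_subtopology
    unfolding shift_space_def shift_top_def by blast
qed

lemma metrizable_space_shift_top: "metrizable_space (shift_top X)"
proof -
  have "metrizable_space (full_shift_top :: (int \<Rightarrow> 'a) topology)"
    unfolding full_shift_top_def
    by (simp add: metrizable_space_product_topology metrizable_space_discrete_topology)
  then show ?thesis
    by (simp add: shift_top_def metrizable_space_subtopology)
qed

lemma continuous_map_coordinate:
  "continuous_map (shift_top X) (discrete_topology UNIV) (\<lambda>x. x i)"
  unfolding shift_top_def full_shift_top_def
  by (intro continuous_map_from_subtopology continuous_map_product_projection) simp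

lemma continuous_map_into_shift_top:
  assumes "\<And>i. continuous_map T (discrete_topology UNIV) (\<lambda>x. f x i)"
    and "f ` topspace T \<subseteq> X"
  shows "continuous_map T (shift_top X) f"
  unfolding shift_top_def full_shift_top_def
  using assms by (auto simp: continuous_map_in_subtopology continuous_map_componentwise_UNIV)

section \<open>Cylinder sets as a countable base\<close>

definition cylinder :: "(int \<Rightarrow> 'a) set \<Rightarrow> nat \<Rightarrow> (int \<Rightarrow> 'a) \<Rightarrow> (int \<Rightarrow> 'a) set" where
  "cylinder X n z = {x \<in> X. \<forall>i\<in>{-int n..int n}. x i = z i}"

lemma openin_coordinate_sets:
  assumes "finite I"
  shows "openin (shift_top X) {x \<in> X. \<forall>i\<in>I. x i \<in> B i}"
proof -
  have "openin (shift_top X) {x \<in> X. x i \<in> B i}" for i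
    using openin_continuous_map_preimage[OF continuous_map_coordinate[of X i], of "B i"] by simp
  \<comment> \<open>Intersecting with \<open>X\<close> also covers empty \<open>I\<close>, where the
    intersection of the family alone would be the whole type.\<close>
  then have "openin (shift_top X) (X \<inter> \<Inter>((\<lambda>i. {x \<in> X. x i \<in> B i}) ` I))"
    using assms openin_topspace[of "shift_top X"]
    by (cases "I = {}") (auto intro!: openin_Int openin_Inter)
  moreover have "X \<inter> \<Inter>((\<lambda>i. {x \<in> X. x i \<in> B i}) ` I) = {x \<in> X. \<forall>i\<in>I. x i \<in> B i}"
    by auto
  ultimately show ?thesis by simp
qed

lemma openin_cylinder: "openin (shift_top X) (cylinder X n z)"
  using openin_coordinate_sets[of "{-int n..int n}" X "\<lambda>i. {z i}"]
  by (simp add: cylinder_def)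

text \<open>Here \<open>I\<close> may be infinite: the complement is a union of open sets, each
  violating the constraint at one coordinate.\<close>

lemma closedin_coordinate_sets:
  "closedin (shift_top X) {x \<in> X. \<forall>i\<in>I. x i \<in> B i}"
proof -
  have "openin (shift_top X) {x \<in> X. x i \<in> - B i}" for i
    using openin_coordinate_sets[of "{i}" X "\<lambda>i. - B i"] by simp
  then have "openin (shift_top X) (\<Union>i\<in>I. {x \<in> X. x i \<in> - B i})"
    by blast
  moreover have "(\<Union>i\<in>I. {x \<in> X. x i \<in> - B i}) = X - {x \<in> X. \<forall>i\<in>I. x i \<in> B i}"
    by auto
  ultimately show ?thesis
    by (simp add: closedin_def)
qed

text \<open>A basic open set of the product constrains finitely many coordinates, and a large enough
  symmetric window contains them all.\<close>

lemma cylinder_base: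
  assumes "openin (shift_top X) U" "x \<in> U"
  obtains n where "cylinder X n x \<subseteq> U"
proof -
  obtain V where V: "openin full_shift_top V" "U = V \<inter> X"
    using assms(1) by (auto simp: shift_top_def openin_subtopology)
  then have "\<exists>B. finite {i. B i \<noteq> UNIV} \<and> x \<in> Pi\<^sub>E UNIV B \<and> Pi\<^sub>E UNIV B \<subseteq> V"
    using assms(2) unfolding full_shift_top_def openin_product_topology_alt by simp
  then obtain B where B: "finite {i. B i \<noteq> UNIV}" "x \<in> Pi\<^sub>E UNIV B" "Pi\<^sub>E UNIV B \<subseteq> V"
    by blast
  \<comment> \<open>\<open>insert 0\<close> keeps the maximum meaningful when no coordinate is
    constrained.\<close>
  define n where "n = nat (Max (insert 0 ((\<lambda>i. \<bar>i\<bar>) ` {i. B i \<noteq> UNIV})))"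
  have bound: "\<bar>i\<bar> \<le> int n" if "B i \<noteq> UNIV" for i
  proof -
    have "\<bar>i\<bar> \<le> Max (insert 0 ((\<lambda>i. \<bar>i\<bar>) ` {i. B i \<noteq> UNIV}))"
      using that B(1) by (intro Max_ge) auto
    then show ?thesis unfolding n_def by linarith
  qed
  have "z \<in> Pi\<^sub>E UNIV B" if z: "z \<in> cylinder X n x" for z
  proof (simp add: PiE_UNIV_domain Pi_iff, rule allI)
    fix i
    show "z i \<in> B i"
    proof (cases "B i = UNIV")
      case False
      then have "i \<in> {-int n..int n}" using bound[OF False] by auto
      then have "z i = x i" using z by (simp add: cylinder_def)
      then show ?thesis using B(2) by (simp add: PiE_UNIV_domain Pi_iff)
    qed simp
  qed
  then have "cylinder X n x \<subseteq> U"
    using B(3) V(2) unfolding cylinder_def by blast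
  then show thesis by (rule that)
qed

text \<open>A cylinder depends only on the restriction of \<open>z\<close> to its window, and over a
  finite alphabet a window carries finitely many blocks.\<close>

lemma countable_cylinders:
  fixes X :: "(int \<Rightarrow> 'a::finite) set"
  shows "countable (range (\<lambda>(n, z). cylinder X n z))"
proof -
  have "range (\<lambda>(n, z). cylinder X n z)
      \<subseteq> (\<Union>n. cylinder X n ` ({-int n..int n} \<rightarrow>\<^sub>E UNIV))"
  proof clarsimp
    fix n z
    have "cylinder X n z = cylinder X n (restrict z {-int n..int n})"
      by (auto simp: cylinder_def)
    then show "\<exists>m. cylinder X n z \<in> cylinder X m ` ({-int m..int m} \<rightarrow>\<^sub>E UNIV)"
      by (intro exI[of _ n] image_eqI[of _ _ "restrict z {-int n..int n}"]) auto
  qed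
  moreover have "countable (\<Union>n. cylinder X n ` ({-int n..int n} \<rightarrow>\<^sub>E UNIV))"
    by (intro countable_UN ballI countableI_type countable_image
        countable_finite[OF finite_PiE]) auto
  ultimately show ?thesis
    by (rule countable_subset)
qed

section \<open>Iterated shifts\<close>

text \<open>An integer exponent lets one function describe both forward and backward iterates of the
  shift.\<close>

definition translate :: "int \<Rightarrow> (int \<Rightarrow> 'a) \<Rightarrow> (int \<Rightarrow> 'a)" where
  "translate t x = (\<lambda>i. x (i + t))"

lemma shift_map_funpow: "(shift_map ^^ n) x = translate (int n) x"
  by (induction n) (auto simp: translate_def shift_map_def algebra_simps)

lemma translate_unshift [simp]:
  "translate (-1) (shift_map x) = x" "shift_map (translate (-1) x) = x"
  by (simp_all add: translate_def shift_map_def)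

lemma inv_shift_map: "inv shift_map = translate (-1)"
  by (rule inv_unique_comp) (auto simp: fun_eq_iff)

lemma inv_shift_map_funpow: "(inv shift_map ^^ n) x = translate (- int n) x"
  by (induction n) (auto simp: inv_shift_map translate_def algebra_simps)

lemma translate_mem:
  assumes "shift_space X" "x \<in> X"
  shows "translate t x \<in> X"
proof -
  have 1: "shift_map z \<in> X" if "z \<in> X" for z
    using assms(1) that unfolding shift_space_def by blast
  have 2: "inv shift_map z \<in> X" if "z \<in> X" for z
    using assms(1) that unfolding shift_space_def inv_shift_map
    by (metis imageE translate_unshift(1))
  have "(shift_map ^^ n) x \<in> X" "(inv shift_map ^^ n) x \<in> X" for n
    using assms(2) 1 2 by (induction n) auto
  then show ?thesis
    unfolding shift_map_funpow inv_shift_map_funpow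
    by (cases t rule: int_cases2) auto
qed

section \<open>Recurrence of blocks along dense orbits\<close>

lemma dense_in_shift_iff:
  "D \<subseteq> X \<Longrightarrow> dense_in_shift X D \<longleftrightarrow> (\<forall>U. openin (shift_top X) U \<and> U \<noteq> {} \<longrightarrow> D \<inter> U \<noteq> {})"
  unfolding dense_in_shift_def using dense_intersects_open[of "shift_top X" D] by simp

text \<open>Density only yields some time \<open>k \<ge> 0\<close>. Asking the orbit to show the
  central block of \<open>z\<close> displaced by \<open>M \<ge> N\<close> gives a match at
  \<open>M + k\<close>, hence arbitrarily late.\<close>

lemma dense_forward_orbit_matches:
  assumes X: "shift_space X" and D: "dense_in_shift X (forward_orbit x)" "x \<in> X" and z: "z \<in> X"
  shows "\<exists>t\<ge>N. \<forall>i\<in>{-int n..int n}. x (i + t) = z i"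
proof -
  define M where "M = max N 0"
  define U where "U = {w \<in> X. \<forall>j\<in>{-int n+M..int n+M}. w j \<in> {z (j - M)}}"
  have "openin (shift_top X) U"
    unfolding U_def by (rule openin_coordinate_sets) simp
  moreover have "translate (-M) z \<in> U"
    using translate_mem[OF X z, of "- M"] by (auto simp: U_def translate_def)
  moreover have "forward_orbit x \<subseteq> X"
    unfolding forward_orbit_def shift_map_funpow using translate_mem[OF X D(2)] by auto
  ultimately obtain w where "w \<in> forward_orbit x" "w \<in> U"
    using D(1) dense_in_shift_iff by blast
  then obtain k where k: "translate (int k) x \<in> U"
    unfolding forward_orbit_def shift_map_funpow by auto
  have "x (i + (M + int k)) = z i" if "i \<in> {-int n..int n}" for i
  proof -
    have "i + M \<in> {-int n+M..int n+M}" using that by auto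
    then have "translate (int k) x (i + M) = z (i + M - M)"
      using k unfolding U_def by blast
    then show ?thesis by (simp add: translate_def add.assoc)
  qed
  moreover have "M + int k \<ge> N" by (simp add: M_def)
  ultimately show ?thesis by blast
qed

text \<open>Mirror image of the forward case: the block is displaced by \<open>M \<le> N\<close>,
  and a backward time only lowers the position further.\<close>

lemma dense_backward_orbit_matches:
  assumes X: "shift_space X" and D: "dense_in_shift X (backward_orbit x)" "x \<in> X" and z: "z \<in> X"
  shows "\<exists>t\<le>N. \<forall>i\<in>{-int n..int n}. x (i + t) = z i"
proof -
  define M where "M = min N 0"
  define U where "U = {w \<in> X. \<forall>j\<in>{-int n+M..int n+M}. w j \<in> {z (j - M)}}"
  have "openin (shift_top X) U"
    unfolding U_def by (rule openin_coordinate_sets) simp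
  moreover have "translate (-M) z \<in> U"
    using translate_mem[OF X z, of "- M"] by (auto simp: U_def translate_def)
  moreover have "backward_orbit x \<subseteq> X"
    unfolding backward_orbit_def inv_shift_map_funpow using translate_mem[OF X D(2)] by auto
  ultimately obtain w where "w \<in> backward_orbit x" "w \<in> U"
    using D(1) dense_in_shift_iff by blast
  then obtain k where k: "translate (- int k) x \<in> U"
    unfolding backward_orbit_def inv_shift_map_funpow by auto
  have "x (i + (M - int k)) = z i" if "i \<in> {-int n..int n}" for i
  proof -
    have "i + M \<in> {-int n+M..int n+M}" using that by auto
    then have "translate (- int k) x (i + M) = z (i + M - M)"
      using k unfolding U_def by blast
    then show ?thesis by (simp add: translate_def algebra_simps)
  qed
  moreover have "M - int k \<le> N" by (simp add: M_def)
  ultimately show ?thesis by blast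
qed

lemma homeomorphic_maps_shift:
  assumes "shift_space X"
  shows "homeomorphic_maps (shift_top X) (shift_top X) shift_map (translate (-1))"
proof -
  have 1: "shift_map ` X \<subseteq> X"
    using assms by (simp add: shift_space_def)
  have 2: "translate (-1) ` X \<subseteq> X"
    using translate_mem[OF assms] by blast
  have "continuous_map (shift_top X) (shift_top X) shift_map"
    using 1 by (intro continuous_map_into_shift_top) (auto simp: shift_map_def continuous_map_coordinate)
  moreover have "continuous_map (shift_top X) (shift_top X) (translate (-1))"
    using 2 by (intro continuous_map_into_shift_top)
      (auto simp: translate_def continuous_map_coordinate[of _ "_ - 1", simplified])
  ultimately show ?thesis
    by (simp add: homeomorphic_maps_def)
qed

lemma dynamical_system_shift:
  "shift_space X \<Longrightarrow> dynamical_system (shift_top X) shift_map"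
  unfolding dynamical_system_def
  using compact_space_shift_top metrizable_space_shift_top homeomorphic_maps_shift
  by (auto simp: homeomorphic_map_maps)

section \<open>Fibers over doubly transitive points\<close>

text \<open>Choose for each pair of distinct points a coordinate where they differ. The half-line up
  to the maximum of the chosen coordinates sees every difference; for empty \<open>F\<close> the
  claim is vacuous.\<close>

lemma finite_set_separated_right:
  fixes F :: "(int \<Rightarrow> 'a) set"
  assumes "finite F"
  shows "\<exists>N. \<forall>u\<in>F. \<forall>v\<in>F. (\<forall>i\<le>N. u i = v i) \<longrightarrow> u = v"
proof -
  define k where "k = (\<lambda>(u, v). SOME i. u i \<noteq> (v i :: 'a) :: int)"
  have "u = v" if "u \<in> F" "v \<in> F" "\<forall>i\<le>Max (k ` (F \<times> F)). u i = v i" for u v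
  proof (rule ccontr)
    assume "u \<noteq> v"
    then obtain i where "u i \<noteq> v i" by blast
    then have "u (k (u, v)) \<noteq> v (k (u, v))"
      unfolding k_def prod.case by (rule someI)
    moreover have "k (u, v) \<le> Max (k ` (F \<times> F))"
      using that assms by (intro Max_ge) auto
    ultimately show False using that(3) by blast
  qed
  then show ?thesis by blast
qed

lemma finite_set_separated_left:
  fixes F :: "(int \<Rightarrow> 'a) set"
  assumes "finite F"
  shows "\<exists>N. \<forall>u\<in>F. \<forall>v\<in>F. (\<forall>i\<ge>N. u i = v i) \<longrightarrow> u = v"
proof -
  define k where "k = (\<lambda>(u, v). SOME i. u i \<noteq> (v i :: 'a) :: int)"
  have "u = v" if "u \<in> F" "v \<in> F" "\<forall>i\<ge>Min (k ` (F \<times> F)). u i = v i" for u v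
  proof (rule ccontr)
    assume "u \<noteq> v"
    then obtain i where "u i \<noteq> v i" by blast
    then have "u (k (u, v)) \<noteq> v (k (u, v))"
      unfolding k_def prod.case by (rule someI)
    moreover have "Min (k ` (F \<times> F)) \<le> k (u, v)"
      using that assms by (intro Min_le) auto
    ultimately show False using that(3) by blast
  qed
  then show ?thesis by blast
qed

text \<open>Membership is decided by pairs of adjacent symbols, and every such pair of the spliced
  point already occurs in \<open>x\<close> or in \<open>x'\<close>.\<close>

lemma one_step_SFT_splice:
  assumes "one_step_SFT X" "x \<in> X" "x' \<in> X" "x p = x' p"
  shows "(\<lambda>i. if i \<le> p then x i else x' i) \<in> X"
proof -
  let ?s = "\<lambda>i. if i \<le> p then x i else x' i"
  obtain F where F: "\<forall>w\<in>F. length w = 2" "X = forbid F"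
    using assms(1) by (auto simp: one_step_SFT_def)
  have "\<not> occurs_in w ?s" if w: "w \<in> F" for w
  proof
    assume "occurs_in w ?s"
    then obtain i where i: "\<forall>k<length w. ?s (i + int k) = w ! k"
      unfolding occurs_in_def by blast
    have len: "length w = 2" using F(1) w by blast
    have s0: "?s i = w ! 0" and s1: "?s (i + 1) = w ! 1"
      using i[rule_format, of 0] i[rule_format, of 1] len by (auto split: if_splits)
    have occ: "occurs_in w z" if "z i = w ! 0" "z (i + 1) = w ! 1" for z
      unfolding occurs_in_def len using that by (intro exI[of _ i]) (auto simp: less_2_cases_iff)
    show False
    proof (cases "i + 1 \<le> p")
      case True
      then have "occurs_in w x" using s0 s1 by (intro occ) auto
      then show False using assms(2) F(2) w by (auto simp: forbid_def)
    next
      case False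
      \<comment> \<open>The pair straddling the seam starts at \<open>p\<close>; since
        \<open>x p = x' p\<close>, it can be read entirely in \<open>x'\<close>.\<close>
      then have "x' i = w ! 0" using s0 assms(4) by (cases "i = p") (auto split: if_splits)
      then have "occurs_in w x'" using s1 False by (intro occ) auto
      then show False using assms(3) F(2) w by (auto simp: forbid_def)
    qed
  qed
  then show ?thesis using F(2) by (auto simp: forbid_def)
qed

section \<open>Finite-to-one one-block codes and the symbols shown by their fibers\<close>

locale one_block_code =
  fixes X :: "(int \<Rightarrow> 'a::finite) set" and Y :: "(int \<Rightarrow> 'b::finite) set"
    and \<pi> :: "(int \<Rightarrow> 'a) \<Rightarrow> (int \<Rightarrow> 'b)"
  assumes sft: "one_step_SFT X" and code: "factor_code X Y \<pi>"
    and block: "one_block X \<pi>" and fin: "finite_to_one X Y \<pi>"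
begin

lemma shift_spaces: "shift_space X" "shift_space Y"
  using code by (auto simp: factor_code_def)

lemma image_code: "\<pi> ` X = Y"
  using code by (auto simp: factor_code_def)

definition \<Phi> :: "'a \<Rightarrow> 'b" where
  "\<Phi> = (SOME \<Phi>. \<forall>x\<in>X. \<forall>i. \<pi> x i = \<Phi> (x i))"

lemma code_apply: "x \<in> X \<Longrightarrow> \<pi> x i = \<Phi> (x i)"
  using someI_ex[OF block[unfolded one_block_def]] unfolding \<Phi>_def by blast

lemma fiber_iff: "x \<in> fiber X \<pi> y \<longleftrightarrow> x \<in> X \<and> (\<forall>i. \<Phi> (x i) = y i)"
  using code_apply by (auto simp: fiber_def fun_eq_iff)

lemma finite_fiber: "y \<in> Y \<Longrightarrow> finite (fiber X \<pi> y)"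
  using fin by (auto simp: finite_to_one_def)

lemma fiber_nonempty: "y \<in> Y \<Longrightarrow> fiber X \<pi> y \<noteq> {}"
  using image_code by (auto simp: fiber_def)

definition symbols_at :: "(int \<Rightarrow> 'b) \<Rightarrow> int \<Rightarrow> 'a set" where
  "symbols_at y p = (\<lambda>x. x p) ` fiber X \<pi> y"

lemma symbols_at_window:
  "\<exists>n. \<forall>x\<in>X. (\<forall>i\<in>{-int n..int n}. \<Phi> (x i) = y i) \<longrightarrow> x p \<in> symbols_at y p"
proof (rule ccontr)
  assume not: "\<not> ?thesis"
  \<comment> \<open>Writing the set as coordinate constraints makes it visibly closed;
    \<open>p\<close> is inserted because it may lie outside the window.\<close>
  define C where "C n = {x \<in> X. \<forall>i\<in>insert p {-int n..int n}. x i \<in>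
     (if i = p then - symbols_at y p else UNIV) \<inter> (if i \<in> {-int n..int n} then \<Phi> -` {y i} else UNIV)}"
    for n
  have C: "x \<in> C n \<longleftrightarrow> x \<in> X \<and> x p \<notin> symbols_at y p \<and> (\<forall>i\<in>{-int n..int n}. \<Phi> (x i) = y i)" for x n
    unfolding C_def by auto
  have "(\<Inter>n. C n) \<noteq> {}"
  proof (rule compact_space_imp_nest)
    show "compact_space (shift_top X)"
      using compact_space_shift_top shift_spaces by blast
    show "closedin (shift_top X) (C n)" for n
      unfolding C_def by (rule closedin_coordinate_sets)
    show "C n \<noteq> {}" for n
      using not C by blast
    show "decseq C"
      unfolding decseq_def by (auto simp: C)
  qed
  then obtain x where x: "\<And>n. x \<in> C n" by blast
  have "\<Phi> (x i) = y i" for i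
  proof -
    have "i \<in> {- int (nat \<bar>i\<bar>)..int (nat \<bar>i\<bar>)}" by auto
    then show ?thesis using x[of "nat \<bar>i\<bar>"] unfolding C by blast
  qed
  then have "x \<in> fiber X \<pi> y"
    using x C by (auto simp: fiber_iff)
  then show False using x C by (auto simp: symbols_at_def)
qed

text \<open>A semicontinuity property: translating a preimage of \<open>y'\<close> by
  \<open>t\<close> gives a point whose image agrees with \<open>y\<close> on the window, so its
  symbol at \<open>p\<close> is one that a true preimage of \<open>y\<close> shows.\<close>

lemma symbols_at_recurrence:
  "\<exists>n. \<forall>y' t. (\<forall>i\<in>{-int n..int n}. y' (i + t) = y i) \<longrightarrow> symbols_at y' (p + t) \<subseteq> symbols_at y p"
proof -
  obtain n where n: "\<And>x. x \<in> X \<Longrightarrow> (\<forall>i\<in>{-int n..int n}. \<Phi> (x i) = y i) \<Longrightarrow> x p \<in> symbols_at y p"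
    using symbols_at_window by blast
  have "symbols_at y' (p + t) \<subseteq> symbols_at y p"
    if m: "\<forall>i\<in>{-int n..int n}. y' (i + t) = y i" for y' t
  proof
    fix a assume "a \<in> symbols_at y' (p + t)"
    then obtain x where x: "x \<in> fiber X \<pi> y'" "a = x (p + t)"
      by (auto simp: symbols_at_def)
    have "translate t x p \<in> symbols_at y p"
    proof (rule n)
      show "translate t x \<in> X"
        using x translate_mem[OF shift_spaces(1)] by (simp add: fiber_iff)
      show "\<forall>i\<in>{-int n..int n}. \<Phi> (translate t x i) = y i"
        using x m by (auto simp: fiber_iff translate_def)
    qed
    then show "a \<in> symbols_at y p" using x by (simp add: translate_def)
  qed
  then show ?thesis by blast
qed

text \<open>A copy of the block of \<open>x\<close> on \<open>{l..r}\<close>, moved by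
  \<open>t\<close>, is inserted between \<open>u\<close> and \<open>v\<close>. Both seams match, and
  the image is still \<open>y\<close> because \<open>y\<close> repeats its own block there.\<close>

lemma fiber_splice:
  assumes u: "u \<in> fiber X \<pi> y" and v: "v \<in> fiber X \<pi> y" and x: "x \<in> fiber X \<pi> y"
    and l: "u (l + t) = x l" and r: "v (r + t) = x r" and "l \<le> r"
    and m: "\<forall>i\<in>{l..r}. y (i + t) = y i"
  shows "(\<lambda>i. if i \<le> l + t then u i else if i \<le> r + t then x (i - t) else v i) \<in> fiber X \<pi> y"
    (is "?s \<in> _")
proof -
  have "translate (-t) x \<in> X"
    using x translate_mem[OF shift_spaces(1)] by (simp add: fiber_iff)
  then have "(\<lambda>i. if i \<le> r + t then translate (-t) x i else v i) \<in> X"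
    using v r by (intro one_step_SFT_splice[OF sft]) (auto simp: fiber_iff translate_def)
  from one_step_SFT_splice[OF sft _ this, of u "l + t"]
  have "(\<lambda>i. if i \<le> l + t then u i
      else (\<lambda>i. if i \<le> r + t then translate (-t) x i else v i) i) \<in> X"
    using u l \<open>l \<le> r\<close> by (simp add: fiber_iff translate_def)
  then have "?s \<in> X"
    unfolding translate_def by (simp only: diff_conv_add_uminus)
  moreover have "\<Phi> (?s i) = y i" for i
  proof -
    have "y i = y (i - t)" if "l + t < i" "i \<le> r + t"
      using m[rule_format, of "i - t"] that by simp
    then show ?thesis using u v x by (auto simp: fiber_iff)
  qed
  ultimately show ?thesis by (simp add: fiber_iff)
qed

text \<open>If two preimages agreed at \<open>p\<close> but differed on one side of it, the block carrying the
  difference could be spliced in at every recurrence of a long window of \<open>y\<close>. This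
  produces pairs of distinct points in the finite fiber that agree on arbitrarily long half-lines.\<close>

lemma minimal_symbols_inj:
  assumes y: "doubly_transitive Y y"
    and min: "\<And>q. card (symbols_at y p) \<le> card (symbols_at y q)"
  shows "inj_on (\<lambda>x. x p) (fiber X \<pi> y)"
proof (rule inj_onI)
  fix x x' assume x: "x \<in> fiber X \<pi> y" and x': "x' \<in> fiber X \<pi> y" and xp: "x p = x' p"
  have yY: "y \<in> Y" and fwd: "dense_in_shift Y (forward_orbit y)"
    and bwd: "dense_in_shift Y (backward_orbit y)"
    using y by (auto simp: doubly_transitive_def)
  have F: "finite (fiber X \<pi> y)" using finite_fiber[OF yY] .
  \<comment> \<open>Recurrence gives an inclusion of symbol sets; at a position of minimal
    cardinality the inclusion must be an equality.\<close>
  have match_minimal: "\<exists>n. \<forall>t. (\<forall>i\<in>{-int n..int n}. y (i + t) = y i)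
      \<longrightarrow> symbols_at y (q + t) = symbols_at y q"
    if q: "card (symbols_at y q) = card (symbols_at y p)" for q
  proof -
    obtain n where n: "\<And>t. (\<forall>i\<in>{-int n..int n}. y (i + t) = y i)
        \<Longrightarrow> symbols_at y (q + t) \<subseteq> symbols_at y q"
      using symbols_at_recurrence by blast
    have "symbols_at y (q + t) = symbols_at y q"
      if "\<forall>i\<in>{-int n..int n}. y (i + t) = y i" for t
      using n[OF that] min[of "q + t"] q by (intro card_seteq) auto
    then show ?thesis by blast
  qed
  \<comment> \<open>At two minimal positions \<open>l\<close> and \<open>r\<close>, every symbol
    shown by a preimage recurs at distance \<open>t\<close>. So some \<open>u\<close> and
    \<open>v\<close> in the fiber supply the seams needed to insert the block of any
    preimage.\<close>
  have branch: "\<exists>n. \<forall>t. (\<forall>i\<in>{-int n..int n}. y (i + t) = y i) \<longrightarrow>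
      (\<forall>z\<in>fiber X \<pi> y. \<exists>u\<in>fiber X \<pi> y. \<exists>v\<in>fiber X \<pi> y. u (l + t) = z l \<and> v (r + t) = z r)
      \<and> (\<forall>i\<in>{l..r}. y (i + t) = y i)"
    if l: "card (symbols_at y l) = card (symbols_at y p)"
      and r: "card (symbols_at y r) = card (symbols_at y p)" for l r
  proof -
    obtain n1 where n1: "\<And>t. (\<forall>i\<in>{-int n1..int n1}. y (i + t) = y i)
      \<Longrightarrow> symbols_at y (l + t) = symbols_at y l" using match_minimal[OF l] by blast
    obtain n2 where n2: "\<And>t. (\<forall>i\<in>{-int n2..int n2}. y (i + t) = y i)
      \<Longrightarrow> symbols_at y (r + t) = symbols_at y r" using match_minimal[OF r] by blast
    \<comment> \<open>The radius covers both recurrence windows and the whole interval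
      \<open>{l..r}\<close>.\<close>
    define n where "n = max (max n1 n2) (max (nat \<bar>l\<bar>) (nat \<bar>r\<bar>))"
    have bounds: "n1 \<le> n" "n2 \<le> n" "- int n \<le> l" "r \<le> int n"
      unfolding n_def by linarith+
    have "(\<forall>z\<in>fiber X \<pi> y. \<exists>u\<in>fiber X \<pi> y. \<exists>v\<in>fiber X \<pi> y. u (l + t) = z l \<and> v (r + t) = z r)
      \<and> (\<forall>i\<in>{l..r}. y (i + t) = y i)"
      if t: "\<forall>i\<in>{-int n..int n}. y (i + t) = y i" for t
    proof -
      have "symbols_at y (l + t) = symbols_at y l" "symbols_at y (r + t) = symbols_at y r"
        using t bounds by (auto intro!: n1 n2)
      then have "z l \<in> symbols_at y (l + t) \<and> z r \<in> symbols_at y (r + t)"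
        if "z \<in> fiber X \<pi> y" for z
        using that by (auto simp: symbols_at_def)
      then have "\<exists>u\<in>fiber X \<pi> y. \<exists>v\<in>fiber X \<pi> y. u (l + t) = z l \<and> v (r + t) = z r"
        if "z \<in> fiber X \<pi> y" for z
        using that unfolding symbols_at_def image_iff by metis
      moreover have "\<forall>i\<in>{l..r}. y (i + t) = y i"
        using t bounds by auto
      ultimately show ?thesis by blast
    qed
    then show ?thesis by blast
  qed
  obtain n0 where n0: "\<And>t. (\<forall>i\<in>{-int n0..int n0}. y (i + t) = y i)
      \<Longrightarrow> symbols_at y (p + t) = symbols_at y p" using match_minimal[of p] by blast
  show "x = x'"
  proof (rule ext, rule ccontr)
    fix j assume j: "x j \<noteq> x' j"
    then consider "p < j" | "j < p" using xp by (metis linorder_neqE)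
    then show False
    proof cases
      case 1
      \<comment> \<open>Forward recurrence gives a second minimal position \<open>r = p + t0\<close>
        at or beyond \<open>j\<close>, so the block from \<open>p\<close> to \<open>r\<close>
        carries the difference.\<close>
      obtain t0 where t0: "t0 \<ge> j - p" "\<forall>i\<in>{-int n0..int n0}. y (i + t0) = y i"
        using dense_forward_orbit_matches[OF shift_spaces(2) fwd yY yY] by blast
      define r where "r = p + t0"
      have r: "j \<le> r" "card (symbols_at y r) = card (symbols_at y p)"
        using t0(1) n0[OF t0(2)] by (simp_all add: r_def)
      obtain n where n: "\<And>t. (\<forall>i\<in>{-int n..int n}. y (i + t) = y i) \<Longrightarrow>
          (\<forall>z\<in>fiber X \<pi> y. \<exists>u\<in>fiber X \<pi> y. \<exists>v\<in>fiber X \<pi> y. u (p + t) = z p \<and> v (r + t) = z r)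
          \<and> (\<forall>i\<in>{p..r}. y (i + t) = y i)"
        using branch[OF refl r(2)] by blast
      obtain N where N: "\<And>u v. u \<in> fiber X \<pi> y \<Longrightarrow> v \<in> fiber X \<pi> y \<Longrightarrow> (\<forall>i\<le>N. u i = v i) \<Longrightarrow> u = v"
        using finite_set_separated_right[OF F] by blast
      obtain t where t: "t \<ge> N - p" "\<forall>i\<in>{-int n..int n}. y (i + t) = y i"
        using dense_forward_orbit_matches[OF shift_spaces(2) fwd yY yY] by blast
      have m: "\<forall>i\<in>{p..r}. y (i + t) = y i" using n[OF t(2)] by blast
      obtain u v where u: "u \<in> fiber X \<pi> y" "u (p + t) = x p" and v: "v \<in> fiber X \<pi> y" "v (r + t) = x r"
        using n[OF t(2)] x by blast
      obtain v' where v': "v' \<in> fiber X \<pi> y" "v' (r + t) = x' r"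
        using n[OF t(2)] x' by blast
      \<comment> \<open>Both points start with the same \<open>u\<close>, which fits since
        \<open>x p = x' p\<close>. They agree up to \<open>p + t \<ge> N\<close>, so the choice of
        \<open>N\<close> makes them equal, yet at \<open>j + t\<close> they show \<open>x j\<close>
        and \<open>x' j\<close>.\<close>
      let ?s = "\<lambda>i. if i \<le> p + t then u i else if i \<le> r + t then x (i - t) else v i"
      let ?s' = "\<lambda>i. if i \<le> p + t then u i else if i \<le> r + t then x' (i - t) else v' i"
      have "?s = ?s'"
      proof (rule N)
        show "?s \<in> fiber X \<pi> y"
          using u v x m 1 r(1) by (intro fiber_splice) auto
        show "?s' \<in> fiber X \<pi> y"
          using u v' x' m 1 r(1) xp by (intro fiber_splice) auto
        show "\<forall>i\<le>N. ?s i = ?s' i" using t(1) by auto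
      qed
      from fun_cong[OF this, of "j + t"] show False using 1 r(1) j by simp
    next
      case 2
      \<comment> \<open>The bound puts \<open>l = p + t0\<close> strictly left of \<open>j\<close>,
        so that \<open>j + t\<close> falls in the middle piece of the splice.\<close>
      obtain t0 where t0: "t0 \<le> j - p - 1" "\<forall>i\<in>{-int n0..int n0}. y (i + t0) = y i"
        using dense_backward_orbit_matches[OF shift_spaces(2) bwd yY yY] by blast
      define l where "l = p + t0"
      have l: "l < j" "card (symbols_at y l) = card (symbols_at y p)"
        using t0(1) n0[OF t0(2)] by (simp_all add: l_def)
      obtain n where n: "\<And>t. (\<forall>i\<in>{-int n..int n}. y (i + t) = y i) \<Longrightarrow>
          (\<forall>z\<in>fiber X \<pi> y. \<exists>u\<in>fiber X \<pi> y. \<exists>v\<in>fiber X \<pi> y. u (l + t) = z l \<and> v (p + t) = z p)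
          \<and> (\<forall>i\<in>{l..p}. y (i + t) = y i)"
        using branch[OF l(2) refl] by blast
      obtain N where N: "\<And>u v. u \<in> fiber X \<pi> y \<Longrightarrow> v \<in> fiber X \<pi> y \<Longrightarrow> (\<forall>i\<ge>N. u i = v i) \<Longrightarrow> u = v"
        using finite_set_separated_left[OF F] by blast
      \<comment> \<open>Now \<open>p + t < N\<close>, so from \<open>N\<close> on both spliced
        points follow the same \<open>v\<close>.\<close>
      obtain t where t: "t \<le> N - p - 1" "\<forall>i\<in>{-int n..int n}. y (i + t) = y i"
        using dense_backward_orbit_matches[OF shift_spaces(2) bwd yY yY] by blast
      have m: "\<forall>i\<in>{l..p}. y (i + t) = y i" using n[OF t(2)] by blast
      obtain u v where u: "u \<in> fiber X \<pi> y" "u (l + t) = x l" and v: "v \<in> fiber X \<pi> y" "v (p + t) = x p"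
        using n[OF t(2)] x by blast
      obtain u' where u': "u' \<in> fiber X \<pi> y" "u' (l + t) = x' l"
        using n[OF t(2)] x' by blast
      let ?s = "\<lambda>i. if i \<le> l + t then u i else if i \<le> p + t then x (i - t) else v i"
      let ?s' = "\<lambda>i. if i \<le> l + t then u' i else if i \<le> p + t then x' (i - t) else v i"
      have "?s = ?s'"
      proof (rule N)
        show "?s \<in> fiber X \<pi> y"
          using u v x m 2 l(1) by (intro fiber_splice) auto
        show "?s' \<in> fiber X \<pi> y"
          using u' v x' m 2 l(1) xp by (intro fiber_splice) auto
        show "\<forall>i\<ge>N. ?s i = ?s' i" using t(1) l(1) 2 by auto
      qed
      from fun_cong[OF this, of "j + t"] show False using 2 l(1) j by simp
    qed
  qed
qed

section \<open>Constancy of the fiber size and mutual separation\<close>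

lemma ex_minimal_symbols: "\<exists>p. \<forall>q. card (symbols_at y p) \<le> card (symbols_at y q)"
  using ex_has_least_nat[of "\<lambda>_. True" 0 "\<lambda>p. card (symbols_at y p)"] by blast

text \<open>Injectivity at a minimal position shows that the minimum equals the fiber size, which
  bounds the count from above everywhere. Hence all positions are minimal.\<close>

lemma card_symbols_at:
  assumes "doubly_transitive Y y"
  shows "card (symbols_at y p) = card (fiber X \<pi> y)"
proof -
  have F: "finite (fiber X \<pi> y)"
    using assms finite_fiber by (auto simp: doubly_transitive_def)
  obtain q where q: "\<And>r. card (symbols_at y q) \<le> card (symbols_at y r)"
    using ex_minimal_symbols by blast
  have "card (symbols_at y q) = card (fiber X \<pi> y)"
    unfolding symbols_at_def using minimal_symbols_inj[OF assms q] by (rule card_image)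
  moreover have "card (symbols_at y p) \<le> card (fiber X \<pi> y)"
    unfolding symbols_at_def using F by (rule card_image_le)
  ultimately show ?thesis using q[of p] by simp
qed

text \<open>Since every position is minimal, evaluation is injective on the fiber at every
  coordinate.\<close>

lemma fiber_mutually_separated:
  assumes "doubly_transitive Y y" "x \<in> fiber X \<pi> y" "x' \<in> fiber X \<pi> y" "x \<noteq> x'"
  shows "mutually_separated x x'"
  unfolding mutually_separated_def
proof (intro allI notI)
  fix i assume "x i = x' i"
  moreover have "inj_on (\<lambda>x. x i) (fiber X \<pi> y)"
    by (rule minimal_symbols_inj[OF assms(1)]) (simp add: card_symbols_at[OF assms(1)])
  ultimately show False using assms by (auto dest: inj_onD)
qed

text \<open>The orbit of \<open>y'\<close> shows the window of \<open>y\<close> around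
  \<open>0\<close>, and there its symbol set embeds into that of \<open>y\<close>. Exchanging the
  two points gives equality.\<close>

lemma card_fiber_le:
  assumes y: "doubly_transitive Y y" and y': "doubly_transitive Y y'"
  shows "card (fiber X \<pi> y') \<le> card (fiber X \<pi> y)"
proof -
  have Y: "y \<in> Y" "y' \<in> Y" "dense_in_shift Y (forward_orbit y')"
    using y y' by (auto simp: doubly_transitive_def)
  obtain n where n: "\<And>t. (\<forall>i\<in>{-int n..int n}. y' (i + t) = y i)
      \<Longrightarrow> symbols_at y' (0 + t) \<subseteq> symbols_at y 0"
    using symbols_at_recurrence[where p = 0] by blast
  obtain t where "\<forall>i\<in>{-int n..int n}. y' (i + t) = y i"
    using dense_forward_orbit_matches[OF shift_spaces(2) Y(3) Y(2) Y(1)] by blast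
  then have "card (symbols_at y' (0 + t)) \<le> card (symbols_at y 0)"
    by (intro card_mono n) auto
  then show ?thesis by (simp add: card_symbols_at[OF y] card_symbols_at[OF y'])
qed

text \<open>The definite description is resolved by constancy of the fiber size for existence and by
  \<open>y\<close> itself for uniqueness.\<close>

lemma card_fiber_eq_code_degree:
  assumes "doubly_transitive Y y"
  shows "card (fiber X \<pi> y) = code_degree X Y \<pi>"
proof -
  have fib: "finite (fiber X \<pi> z) \<and> card (fiber X \<pi> z) = card (fiber X \<pi> y)"
    if "doubly_transitive Y z" for z
    using that le_antisym[OF card_fiber_le card_fiber_le, OF assms that that assms] finite_fiber
    by (simp add: doubly_transitive_def)
  show ?thesis
    unfolding code_degree_def
    by (rule the_equality[symmetric]) (use fib assms in blast)+
qed

end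

section \<open>Invariant measures\<close>

lemma space_borel_of [simp]: "space (borel_of T) = topspace T"
  by (simp add: borel_of_def space_measure_of_conv)

lemma sets_borel_of: "sets (borel_of T) = sigma_sets (topspace T) {U. openin T U}"
  unfolding borel_of_def by (rule sets_measure_of) (auto dest: openin_subset)

lemma openin_in_sets: "openin T U \<Longrightarrow> U \<in> sets (borel_of T)"
  by (auto simp: sets_borel_of)

lemma continuous_map_measurable:
  assumes "continuous_map T S f"
  shows "f \<in> measurable (borel_of T) (borel_of S)"
proof (rule measurable_sigma_sets[OF sets_borel_of])
  show "{U. openin S U} \<subseteq> Pow (topspace S)" by (auto dest: openin_subset)
  show "f \<in> space (borel_of T) \<rightarrow> topspace S"
    using continuous_map_image_subset_topspace[OF assms] by auto
  fix U assume "U \<in> {U. openin S U}"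
  then have "openin T {x \<in> topspace T. f x \<in> U}"
    using openin_continuous_map_preimage[OF assms] by blast
  moreover have "{x \<in> topspace T. f x \<in> U} = f -` U \<inter> space (borel_of T)" by auto
  ultimately show "f -` U \<inter> space (borel_of T) \<in> sets (borel_of T)"
    by (metis openin_in_sets)
qed

text \<open>Taking traces on \<open>L\<close> commutes with generating a sigma-algebra from the open
  sets.\<close>

lemma sets_borel_of_subtopology:
  assumes "L \<in> sets (borel_of T)"
  shows "sets (borel_of (subtopology T L)) = sets (restrict_space (borel_of T) L)"
proof -
  have "{U. openin (subtopology T L) U} = (\<inter>) L ` {U. openin T U}"
    by (auto simp: openin_subtopology)
  moreover have "topspace (subtopology T L) = L"
    using sets.sets_into_space[OF assms] by auto
  ultimately have "sets (borel_of (subtopology T L)) = sigma_sets L ((\<inter>) L ` {U. openin T U})"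
    by (simp add: sets_borel_of)
  also have "\<dots> = (\<inter>) L ` sets (borel_of T)"
    using assms sets.sets_into_space[OF assms] unfolding sets_borel_of
    by (simp add: sigma_sets_Int)
  finally show ?thesis by (simp add: sets_restrict_space)
qed

section \<open>Recurrence under ergodic measures\<close>

lemma ergodic_measuresD:
  assumes "\<mu> \<in> ergodic_measures T f"
  shows "prob_space \<mu>" "sets \<mu> = sets (borel_of T)" "space \<mu> = topspace T"
    "f \<in> measurable \<mu> \<mu>" "distr \<mu> \<mu> f = \<mu>"
    "\<And>A. A \<in> sets \<mu> \<Longrightarrow> f -` A \<inter> space \<mu> = A \<Longrightarrow> measure \<mu> A = 0 \<or> measure \<mu> A = 1"
proof -
  show s: "sets \<mu> = sets (borel_of T)" using assms by (simp add: ergodic_measures_def)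
  show "space \<mu> = topspace T" using sets_eq_imp_space_eq[OF s] by simp
qed (use assms in \<open>simp_all add: ergodic_measures_def\<close>)

lemma ergodic_measurable_from:
  assumes "\<mu> \<in> ergodic_measures T f" "continuous_map T S g"
  shows "g \<in> measurable \<mu> (borel_of S)"
  using continuous_map_measurable[OF assms(2)] ergodic_measuresD(2)[OF assms(1)]
    measurable_cong_sets by blast

text \<open>A homeomorphism and its inverse have the same invariant sets and measures. This allows
  backward orbits to be treated like forward ones.\<close>

lemma ergodic_measures_inverse:
  assumes \<mu>: "\<mu> \<in> ergodic_measures T f" and h: "homeomorphic_maps T T f g"
  shows "\<mu> \<in> ergodic_measures T g"
proof -
  note D = ergodic_measuresD[OF \<mu>]
  have gf: "g (f x) = x" "f (g x) = x" "f x \<in> topspace T" "g x \<in> topspace T"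
    if "x \<in> topspace T" for x
    using h that unfolding homeomorphic_maps_def continuous_map_def by auto
  have "continuous_map T T g" using h by (simp add: homeomorphic_maps_def)
  then have g: "g \<in> measurable \<mu> \<mu>"
    using continuous_map_measurable D(2) measurable_cong_sets by blast
  have "distr \<mu> \<mu> g = distr (distr \<mu> \<mu> f) \<mu> g" by (simp add: D(5))
  also have "\<dots> = distr \<mu> \<mu> (\<lambda>x. x)"
    unfolding distr_distr[OF g D(4)] by (rule distr_cong) (auto simp: gf D(3))
  finally have inv: "distr \<mu> \<mu> g = \<mu>" by (simp add: distr_id2)
  have "measure \<mu> A = 0 \<or> measure \<mu> A = 1"
    if A: "A \<in> sets \<mu>" "g -` A \<inter> space \<mu> = A" for A
  proof (rule D(6)[OF A(1)])
    have "f x \<in> A \<longleftrightarrow> x \<in> A" if "x \<in> space \<mu>" for x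
    proof -
      have "f x \<in> A \<longleftrightarrow> f x \<in> g -` A \<inter> space \<mu>" using A(2) by simp
      then show ?thesis using that gf by (simp add: D(3))
    qed
    then show "f -` A \<inter> space \<mu> = A"
      using sets.sets_into_space[OF A(1)] by auto
  qed
  then show ?thesis
    using D(1,2) g inv by (simp add: ergodic_measures_def)
qed

text \<open>The set of points visiting \<open>U\<close> infinitely often is strictly invariant, and it is
  at least as large as \<open>U\<close> in measure.\<close>

lemma ergodic_AE_visits:
  assumes \<mu>: "\<mu> \<in> ergodic_measures T f" and U: "U \<in> sets \<mu>" "emeasure \<mu> U > 0"
  shows "AE x in \<mu>. \<exists>n. (f ^^ n) x \<in> U"
proof -
  note D = ergodic_measuresD[OF \<mu>]
  interpret prob_space \<mu> by (rule D)
  have f: "(f ^^ n) \<in> measurable \<mu> \<mu> \<and> distr \<mu> \<mu> (f ^^ n) = \<mu>" for n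
  proof (induction n)
    case 0
    then show ?case by (simp add: id_def distr_id2)
  next
    case (Suc n)
    then have "distr \<mu> \<mu> (f \<circ> f ^^ n) = distr (distr \<mu> \<mu> (f ^^ n)) \<mu> f"
      using D(4) by (intro distr_distr[symmetric]) auto
    then show ?case using Suc D(4,5) measurable_comp[of "f ^^ n" \<mu> \<mu> f \<mu>] by (simp add: comp_def)
  qed
  \<comment> \<open>These points visit \<open>U\<close> at time \<open>m\<close> or later. The set
    contains the \<open>m\<close>-th preimage of \<open>U\<close>, which has the measure of
    \<open>U\<close>; a single \<open>V m\<close> need not be strictly invariant, unlike the
    intersection of all.\<close>
  define V where "V m = (\<Union>n\<in>{m..}. (f ^^ n) -` U \<inter> space \<mu>)" for m
  have Vs: "V m \<in> sets \<mu>" for m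
    unfolding V_def using f U(1) by (intro sets.countable_UN'') (auto intro: measurable_sets)
  have Vge: "emeasure \<mu> U \<le> emeasure \<mu> (V m)" for m
  proof -
    have "emeasure \<mu> U = emeasure (distr \<mu> \<mu> (f ^^ m)) U" using f by simp
    also have "\<dots> = emeasure \<mu> ((f ^^ m) -` U \<inter> space \<mu>)"
      using f U(1) by (intro emeasure_distr) auto
    also have "\<dots> \<le> emeasure \<mu> (V m)"
      by (rule emeasure_mono[OF _ Vs]) (auto simp: V_def)
    finally show ?thesis .
  qed
  let ?A = "\<Inter>m. V m"
  have "decseq V" unfolding decseq_def V_def by fastforce
  then have "(INF m. emeasure \<mu> (V m)) = emeasure \<mu> ?A"
    using Vs by (intro INF_emeasure_decseq) auto
  then have "emeasure \<mu> U \<le> emeasure \<mu> ?A"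
    using Vge by (metis INF_greatest)
  then have "measure \<mu> ?A \<noteq> 0"
    using U(2) by (auto simp: emeasure_eq_measure)
  moreover have "?A \<in> sets \<mu>" using Vs by auto
  moreover have "f -` ?A \<inter> space \<mu> = ?A"
  proof -
    have "f x \<in> ?A \<longleftrightarrow> x \<in> ?A" if x: "x \<in> space \<mu>" for x
    proof -
      have fx: "f x \<in> space \<mu>" using measurable_space[OF D(4) x] .
      \<comment> \<open>Passing from \<open>x\<close> to \<open>f x\<close> shifts all visiting
        times by one, which does not affect whether they are unbounded.\<close>
      have "f x \<in> ?A \<longleftrightarrow> (\<forall>m. \<exists>n\<ge>m. (f ^^ Suc n) x \<in> U)"
        using fx by (auto simp: V_def funpow_swap1)
      also have "\<dots> \<longleftrightarrow> (\<forall>m. \<exists>n\<ge>m. (f ^^ n) x \<in> U)"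
        by (metis Suc_le_D Suc_le_mono le_SucI)
      also have "\<dots> \<longleftrightarrow> x \<in> ?A" using x by (auto simp: V_def)
      finally show ?thesis .
    qed
    moreover have "?A \<subseteq> space \<mu>" by (auto simp: V_def)
    ultimately show ?thesis by auto
  qed
  ultimately have "measure \<mu> ?A = 1" using D(6) by blast
  then have "AE x in \<mu>. x \<in> ?A" by (rule AE_prob_1)
  then show ?thesis by eventually_elim (auto simp: V_def)
qed

text \<open>Full support gives every nonempty cylinder positive measure, so almost every orbit
  visits it in both time directions. There are countably many cylinders, and they form a
  base.\<close>

lemma AE_doubly_transitive:
  assumes Y: "shift_space Y" and \<nu>: "\<nu> \<in> ergodic_measures (shift_top Y) shift_map"
    and supp: "fully_supported (shift_top Y) \<nu>"
  shows "AE y in \<nu>. doubly_transitive Y y"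
proof -
  note D = ergodic_measuresD[OF \<nu>]
  have \<nu>': "\<nu> \<in> ergodic_measures (shift_top Y) (inv shift_map)"
    unfolding inv_shift_map using ergodic_measures_inverse[OF \<nu> homeomorphic_maps_shift[OF Y]] .
  \<comment> \<open>The centre of a cylinder need not lie in \<open>Y\<close>, so empty cylinders
    occur and are removed.\<close>
  define \<C> where "\<C> = range (\<lambda>(n, z). cylinder Y n z) - {{}}"
  have "countable \<C>" unfolding \<C>_def using countable_cylinders by blast
  have C: "C \<in> sets \<nu>" "emeasure \<nu> C > 0" if mem: "C \<in> \<C>" for C
  proof -
    obtain n z where o: "C = cylinder Y n z" using mem unfolding \<C>_def by auto
    then have op: "openin (shift_top Y) C" by (simp add: openin_cylinder)
    then show "C \<in> sets \<nu>" by (simp add: D(2) openin_in_sets)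
    obtain x where "x \<in> C" using mem unfolding \<C>_def by auto
    then have "x \<in> topological_support (shift_top Y) \<nu>"
      using supp o by (auto simp: fully_supported_def cylinder_def)
    then show "emeasure \<nu> C > 0"
      using op \<open>x \<in> C\<close> by (auto simp: topological_support_def)
  qed
  have "AE y in \<nu>. \<forall>C\<in>\<C>. \<exists>n. (shift_map ^^ n) y \<in> C"
    using ergodic_AE_visits[OF \<nu> C] \<open>countable \<C>\<close> by (simp add: AE_ball_countable)
  moreover have "AE y in \<nu>. \<forall>C\<in>\<C>. \<exists>n. (inv shift_map ^^ n) y \<in> C"
    using ergodic_AE_visits[OF \<nu>' C] \<open>countable \<C>\<close> by (simp add: AE_ball_countable)
  moreover have "AE y in \<nu>. y \<in> Y" using AE_space[of \<nu>] by (simp add: D(3))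
  ultimately show ?thesis
  proof eventually_elim
    case (elim y)
    have sub: "\<exists>C\<in>\<C>. C \<subseteq> U" if U: "openin (shift_top Y) U" "U \<noteq> {}" for U
    proof -
      obtain x where x: "x \<in> U" using U(2) by blast
      obtain n where "cylinder Y n x \<subseteq> U" using cylinder_base[OF U(1) x] .
      moreover have "x \<in> Y" using x openin_subset[OF U(1)] by auto
      then have "cylinder Y n x \<in> \<C>" by (auto simp: \<C>_def cylinder_def)
      ultimately show ?thesis by blast
    qed
    have orb: "forward_orbit y \<subseteq> Y" "backward_orbit y \<subseteq> Y"
      using translate_mem[OF Y elim(3)]
      by (auto simp: forward_orbit_def backward_orbit_def shift_map_funpow inv_shift_map_funpow)
    have "dense_in_shift Y (forward_orbit y)"
      unfolding dense_in_shift_iff[OF orb(1)]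
    proof (intro allI impI, elim conjE)
      fix U assume "openin (shift_top Y) U" "U \<noteq> {}"
      then obtain C where "C \<in> \<C>" "C \<subseteq> U" using sub by blast
      moreover from this obtain n where "(shift_map ^^ n) y \<in> C" using elim(1) by blast
      ultimately show "forward_orbit y \<inter> U \<noteq> {}" by (auto simp: forward_orbit_def)
    qed
    moreover have "dense_in_shift Y (backward_orbit y)"
      unfolding dense_in_shift_iff[OF orb(2)]
    proof (intro allI impI, elim conjE)
      fix U assume "openin (shift_top Y) U" "U \<noteq> {}"
      then obtain C where "C \<in> \<C>" "C \<subseteq> U" using sub by blast
      moreover from this obtain n where "(inv shift_map ^^ n) y \<in> C" using elim(2) by blast
      ultimately show "backward_orbit y \<inter> U \<noteq> {}" by (auto simp: backward_orbit_def)
    qed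
    ultimately show ?case using elim(3) by (simp add: doubly_transitive_def)
  qed
qed

section \<open>Ergodic measures on an invariant Borel subset\<close>

lemma inclusion_measurable:
  assumes "sets \<mu> = sets (borel_of (subtopology T L))"
  shows "(\<lambda>x. x) \<in> measurable \<mu> (borel_of T)"
proof -
  have "(\<lambda>x. x) \<in> measurable (borel_of (subtopology T L)) (borel_of T)"
    by (intro continuous_map_measurable continuous_map_from_subtopology)
      (rule continuous_map_id[unfolded id_def])
  then show ?thesis using assms measurable_cong_sets by blast
qed

text \<open>As \<open>L\<close> is strictly invariant and has full measure, invariance and the
  zero-one law pass to subsets of \<open>L\<close>, and the null complement is invisible after
  pushing back.\<close>

lemma ergodic_restrict_space:
  assumes \<mu>: "\<mu> \<in> ergodic_measures T f" and L: "L \<in> sets (borel_of T)"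
    and inv: "\<forall>z\<in>topspace T. f z \<in> L \<longleftrightarrow> z \<in> L" and full: "AE z in \<mu>. z \<in> L"
  shows "restrict_space \<mu> L \<in> ergodic_measures (subtopology T L) f"
    and "push_inclusion T (restrict_space \<mu> L) = \<mu>"
proof -
  note D = ergodic_measuresD[OF \<mu>]
  interpret prob_space \<mu> by (rule D)
  let ?R = "restrict_space \<mu> L"
  have L\<mu>: "L \<in> sets \<mu>" and LT: "L \<subseteq> topspace T"
    using L D(2) sets.sets_into_space[OF L] by auto
  have emR: "emeasure ?R A = emeasure \<mu> A" if "A \<subseteq> L" for A
    using that L\<mu> by (intro emeasure_restrict_space) auto
  have setsR: "A \<in> sets ?R \<longleftrightarrow> A \<subseteq> L \<and> A \<in> sets \<mu>" for A
    using L\<mu> by (simp add: sets_restrict_space_iff)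
  have spR: "space ?R = L" using L\<mu> by simp
  have sets_eq: "sets ?R = sets (borel_of (subtopology T L))"
    unfolding sets_borel_of_subtopology[OF L] by (rule sets_restrict_space_cong[OF D(2)])
  have prob: "prob_space ?R"
    using L\<mu> full by (intro prob_space_restrict_space emeasure_eq_1_AE) auto
  have f: "f \<in> measurable ?R ?R"
    using inv LT by (intro measurable_restrict_space2 measurable_restrict_space1 D(4)) (auto simp: spR)
  have "distr ?R ?R f = ?R"
  proof (rule measure_eqI)
    fix A assume "A \<in> sets (distr ?R ?R f)"
    then have A: "A \<subseteq> L" "A \<in> sets \<mu>" by (auto simp: setsR)
    have "emeasure (distr ?R ?R f) A = emeasure ?R (f -` A \<inter> L)"
      using f A by (simp add: emeasure_distr setsR spR)
    \<comment> \<open>The preimage of a subset of \<open>L\<close> lies in \<open>L\<close> by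
      strict invariance, so it is the same in both spaces.\<close>
    also have "f -` A \<inter> L = f -` A \<inter> space \<mu>"
      using A inv LT by (auto simp: D(3))
    also have "emeasure ?R (f -` A \<inter> space \<mu>) = emeasure \<mu> (f -` A \<inter> space \<mu>)"
      using A inv LT by (intro emR) (auto simp: D(3))
    also have "\<dots> = emeasure (distr \<mu> \<mu> f) A"
      using D(4) A by (simp add: emeasure_distr)
    finally show "emeasure (distr ?R ?R f) A = emeasure ?R A"
      using D(5) A by (simp add: emR)
  qed simp
  moreover have "measure ?R A = 0 \<or> measure ?R A = 1"
    if "A \<in> sets ?R" "f -` A \<inter> space ?R = A" for A
  proof -
    have A: "A \<subseteq> L" "A \<in> sets \<mu>" using that(1) by (auto simp: setsR)
    have "f -` A \<inter> space \<mu> = A"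
      using that(2) A inv LT by (auto simp: D(3) spR)
    then have "measure \<mu> A = 0 \<or> measure \<mu> A = 1" using D(6) A by blast
    then show ?thesis using emR[OF A(1)] by (simp add: measure_def)
  qed
  ultimately show "?R \<in> ergodic_measures (subtopology T L) f"
    using prob sets_eq f by (simp add: ergodic_measures_def)
  show "push_inclusion T ?R = \<mu>"
  proof (rule measure_eqI)
    show "sets (push_inclusion T ?R) = sets \<mu>" by (simp add: push_inclusion_def D(2))
    fix A assume "A \<in> sets (push_inclusion T ?R)"
    then have A: "A \<in> sets (borel_of T)" by (simp add: push_inclusion_def)
    have "emeasure (push_inclusion T ?R) A = emeasure ?R (A \<inter> L)"
      unfolding push_inclusion_def using emeasure_distr[OF inclusion_measurable[OF sets_eq] A]
      by (simp add: spR)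
    also have "\<dots> = emeasure \<mu> (A \<inter> L)" by (rule emR) auto
    also have "\<dots> = emeasure \<mu> A"
      using full A L\<mu> D(2) by (intro emeasure_eq_AE) auto
    finally show "emeasure (push_inclusion T ?R) A = emeasure \<mu> A" .
  qed
qed

text \<open>The pushforward only sees \<open>A \<inter> L\<close>, and strict invariance of
  \<open>L\<close> lets intersection with \<open>L\<close> and preimage under \<open>f\<close> be
  exchanged.\<close>

lemma ergodic_push_inclusion:
  assumes \<mu>: "\<mu> \<in> ergodic_measures (subtopology T L) f" and L: "L \<in> sets (borel_of T)"
    and inv: "\<forall>z\<in>topspace T. f z \<in> L \<longleftrightarrow> z \<in> L"
    and f: "continuous_map T T f"
  shows "push_inclusion T \<mu> \<in> ergodic_measures T f" and "AE z in push_inclusion T \<mu>. z \<in> L"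
proof -
  note D = ergodic_measuresD[OF \<mu>]
  interpret prob_space \<mu> by (rule D)
  let ?P = "push_inclusion T \<mu>"
  have LT: "L \<subseteq> topspace T" using sets.sets_into_space[OF L] by simp
  have sp: "space \<mu> = L" using D(3) LT by auto
  note i = inclusion_measurable[OF D(2)]
  have setsP: "sets ?P = sets (borel_of T)" and spP: "space ?P = topspace T"
    by (simp_all add: push_inclusion_def)
  have emP: "emeasure ?P A = emeasure \<mu> (A \<inter> L)" if "A \<in> sets (borel_of T)" for A
    unfolding push_inclusion_def using emeasure_distr[OF i that] by (simp add: sp)
  have prob: "prob_space ?P"
    unfolding push_inclusion_def by (rule prob_space_distr[OF i])
  have fP: "f \<in> measurable ?P ?P"
    using continuous_map_measurable[OF f] setsP measurable_cong_sets by blast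
  have AL: "A \<inter> L \<in> sets \<mu>" if "A \<in> sets (borel_of T)" for A
    using measurable_sets[OF i that] by (simp add: sp)
  have "distr ?P ?P f = ?P"
  proof (rule measure_eqI)
    fix A assume "A \<in> sets (distr ?P ?P f)"
    then have A: "A \<in> sets (borel_of T)" by (simp add: setsP)
    have fA: "f -` A \<inter> topspace T \<in> sets (borel_of T)"
      using measurable_sets[OF continuous_map_measurable[OF f] A] by simp
    have "emeasure (distr ?P ?P f) A = emeasure ?P (f -` A \<inter> topspace T)"
      using fP A by (simp add: emeasure_distr setsP spP)
    also have "\<dots> = emeasure \<mu> (f -` A \<inter> topspace T \<inter> L)" by (rule emP[OF fA])
    also have "f -` A \<inter> topspace T \<inter> L = f -` (A \<inter> L) \<inter> space \<mu>"
      using inv LT by (auto simp: sp)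
    also have "emeasure \<mu> \<dots> = emeasure (distr \<mu> \<mu> f) (A \<inter> L)"
      using D(4) AL[OF A] by (simp add: emeasure_distr)
    finally show "emeasure (distr ?P ?P f) A = emeasure ?P A"
      by (simp add: D(5) emP[OF A])
  qed simp
  moreover have "measure ?P A = 0 \<or> measure ?P A = 1"
    if "A \<in> sets ?P" "f -` A \<inter> space ?P = A" for A
  proof -
    have A: "A \<in> sets (borel_of T)" using that(1) by (simp add: setsP)
    have eq: "z \<in> A \<longleftrightarrow> f z \<in> A" if "z \<in> topspace T" for z
      using \<open>f -` A \<inter> space ?P = A\<close> that by (auto simp: spP)
    have "f -` (A \<inter> L) \<inter> space \<mu> = A \<inter> L"
      using eq inv LT by (auto simp: sp)
    then have "measure \<mu> (A \<inter> L) = 0 \<or> measure \<mu> (A \<inter> L) = 1"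
      using D(6) AL[OF A] by blast
    then show ?thesis using emP[OF A] by (simp add: measure_def)
  qed
  ultimately show "?P \<in> ergodic_measures T f"
    using prob setsP fP by (simp add: ergodic_measures_def)
  have "emeasure ?P L = 1" using emP[OF L] emeasure_space_1 by (simp add: sp)
  then show "AE z in ?P. z \<in> L"
    using prob_space.AE_prob_1[OF prob] by (simp add: measure_def)
qed

section \<open>Powers of a shift space\<close>

lemma topspace_power_shift [simp]: "topspace (power_top d (shift_top X)) = {1..d} \<rightarrow>\<^sub>E X"
  by (simp add: power_top_def)

lemma continuous_map_power_projection:
  "i \<in> {1..d} \<Longrightarrow> continuous_map (power_top d T) T (\<lambda>z. z i)"
  unfolding power_top_def by (rule continuous_map_product_projection)

lemma continuous_map_power_map:
  assumes "continuous_map T T f"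
  shows "continuous_map (power_top d T) (power_top d T) (power_map d f)"
proof -
  have "continuous_map (power_top d T) T (\<lambda>z. f (z i))" if "i \<in> {1..d}" for i
    using continuous_map_compose[OF continuous_map_power_projection[OF that] assms]
    by (simp add: comp_def)
  then show ?thesis
    unfolding power_top_def power_map_def
    by (subst continuous_map_componentwise) (auto simp: power_top_def)
qed

text \<open>For fixed indices and coordinate the finite alphabet gives a finite union of coordinate
  sets; a countable intersection follows. \<open>R\<close> may depend on \<open>i\<close> and
  \<open>j\<close> so that the diagonal can be exempted in \<Lambda>.\<close>

lemma pairwise_symbol_condition_measurable:
  fixes X :: "(int \<Rightarrow> 'a::finite) set"
  shows "{z \<in> {1..d} \<rightarrow>\<^sub>E X. \<forall>i\<in>{1..d}. \<forall>j\<in>{1..d}. \<forall>k. R i j (z i k) (z j k)}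
    \<in> sets (borel_of (power_top d (shift_top X)))" (is "_ \<in> sets ?M")
proof -
  have coord: "{z \<in> {1..d} \<rightarrow>\<^sub>E X. z i k = a} \<in> sets ?M" if "i \<in> {1..d}" for i k a
  proof (rule openin_in_sets)
    have "continuous_map (power_top d (shift_top X)) (discrete_topology UNIV) (\<lambda>z. z i k)"
      using continuous_map_compose[OF continuous_map_power_projection[OF that] continuous_map_coordinate[of X k]]
      by (simp add: comp_def)
    from openin_continuous_map_preimage[OF this, of "{a}"]
    show "openin (power_top d (shift_top X)) {z \<in> {1..d} \<rightarrow>\<^sub>E X. z i k = a}" by simp
  qed
  have pair: "{z \<in> {1..d} \<rightarrow>\<^sub>E X. R i j (z i k) (z j k)} \<in> sets ?M"
    if "i \<in> {1..d}" "j \<in> {1..d}" for i j k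
  proof -
    have "{z \<in> {1..d} \<rightarrow>\<^sub>E X. R i j (z i k) (z j k)} = (\<Union>(a, b)\<in>{(a, b). R i j a b}.
        {z \<in> {1..d} \<rightarrow>\<^sub>E X. z i k = a} \<inter> {z \<in> {1..d} \<rightarrow>\<^sub>E X. z j k = b})"
      by auto
    also have "\<dots> \<in> sets ?M"
      using coord that by (intro sets.finite_UN) auto
    finally show ?thesis .
  qed
  have "{z \<in> space ?M. \<forall>i\<in>{1..d}. \<forall>j\<in>{1..d}. \<forall>k. R i j (z i k) (z j k)} \<in> sets ?M"
    using pair by (intro sets.sets_Collect_finite_All' sets.sets_Collect_finite_All sets.sets_Collect_countable_All) auto
  then show ?thesis by simp
qed

section \<open>Degree joinings\<close>

context one_block_code
begin

abbreviation degree :: nat where "degree \<equiv> code_degree X Y \<pi>"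

abbreviation \<Lambda> :: "(nat \<Rightarrow> int \<Rightarrow> 'a) set" where "\<Lambda> \<equiv> topological_degree_joining X Y \<pi>"

lemma code_eq_iff: "x \<in> X \<Longrightarrow> x' \<in> X \<Longrightarrow> \<pi> x = \<pi> x' \<longleftrightarrow> (\<forall>k. \<Phi> (x k) = \<Phi> (x' k))"
  using code_apply by (auto simp: fun_eq_iff)

lemma fiber_power_eq:
  "fiber_power n X \<pi> = {z \<in> {1..n} \<rightarrow>\<^sub>E X. \<forall>i\<in>{1..n}. \<forall>j\<in>{1..n}. \<forall>k. \<Phi> (z i k) = \<Phi> (z j k)}"
proof -
  have "\<pi> (z i) = \<pi> (z j) \<longleftrightarrow> (\<forall>k. \<Phi> (z i k) = \<Phi> (z j k))"
    if "z \<in> {1..n} \<rightarrow>\<^sub>E X" "i \<in> {1..n}" "j \<in> {1..n}" for z i j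
    using code_eq_iff[OF PiE_mem[OF that(1,2)] PiE_mem[OF that(1,3)]] .
  then show ?thesis
    unfolding fiber_power_def by (intro Collect_cong conj_cong refl) (simp del: atLeastAtMost_iff cong: ball_cong)
qed

text \<open>Pairwise separation of the image set compares distinct points only; injectivity turns
  this into a condition on distinct indices, which fits the measurability criterion.\<close>

lemma degree_joining_eq:
  "\<Lambda> = {z \<in> {1..degree} \<rightarrow>\<^sub>E X. \<forall>i\<in>{1..degree}. \<forall>j\<in>{1..degree}. \<forall>k.
     \<Phi> (z i k) = \<Phi> (z j k) \<and> (i \<noteq> j \<longrightarrow> z i k \<noteq> z j k)}"
proof -
  have "inj_on z I \<and> pairwise mutually_separated (z ` I)
      \<longleftrightarrow> (\<forall>i\<in>I. \<forall>j\<in>I. \<forall>k. i \<noteq> j \<longrightarrow> z i k \<noteq> z j k)" for z :: "nat \<Rightarrow> int \<Rightarrow> 'a" and I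
    by (auto simp: inj_on_def pairwise_def mutually_separated_def) metis+
  then show ?thesis
    unfolding topological_degree_joining_def Let_def fiber_power_eq
    by (simp only: mem_Collect_eq ball_conj_distrib all_conj_distrib conj_assoc)
qed

lemma degree_joining_in_sets: "\<Lambda> \<in> sets (borel_of (power_top degree (shift_top X)))"
  unfolding degree_joining_eq by (rule pairwise_symbol_condition_measurable)

lemma fiber_power_in_sets:
  "fiber_power n X \<pi> \<in> sets (borel_of (power_top n (shift_top X)))"
  unfolding fiber_power_eq by (rule pairwise_symbol_condition_measurable)

text \<open>The conditions range over all integer coordinates, so reindexing by \<open>k + 1\<close>
  preserves them in both directions. This is the strict invariance needed to transfer
  measures.\<close>

lemma power_map_degree_joining_iff:
  assumes "z \<in> {1..degree} \<rightarrow>\<^sub>E X"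
  shows "power_map degree shift_map z \<in> \<Lambda> \<longleftrightarrow> z \<in> \<Lambda>"
proof -
  have "power_map degree shift_map z \<in> {1..degree} \<rightarrow>\<^sub>E X"
    using assms shift_spaces(1) by (auto simp: power_map_def shift_space_def PiE_mem)
  moreover have "(\<forall>k::int. P (k + 1)) \<longleftrightarrow> (\<forall>k. P k)" for P
    by (metis diff_add_cancel)
  then have "(\<forall>k. R (power_map degree shift_map z i k) (power_map degree shift_map z j k))
      \<longleftrightarrow> (\<forall>k. R (z i k) (z j k))" if "i \<in> {1..degree}" "j \<in> {1..degree}" for i j R
    using that by (simp add: power_map_def shift_map_def)
  from this[where R = "\<lambda>a b. \<Phi> a = \<Phi> b \<and> (i \<noteq> j \<longrightarrow> a \<noteq> b)" and i = i and j = j for i j]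
  have "(\<forall>i\<in>{1..degree}. \<forall>j\<in>{1..degree}. \<forall>k.
      \<Phi> (power_map degree shift_map z i k) = \<Phi> (power_map degree shift_map z j k)
      \<and> (i \<noteq> j \<longrightarrow> power_map degree shift_map z i k \<noteq> power_map degree shift_map z j k))
    \<longleftrightarrow> (\<forall>i\<in>{1..degree}. \<forall>j\<in>{1..degree}. \<forall>k. \<Phi> (z i k) = \<Phi> (z j k) \<and> (i \<noteq> j \<longrightarrow> z i k \<noteq> z j k))"
    by (intro ball_cong refl)
  ultimately show ?thesis
    unfolding degree_joining_eq using assms by simp
qed

section \<open>Degree joinings as ergodic measures on \<Lambda>\<close>

lemma continuous_map_code: "continuous_map (shift_top X) (shift_top Y) \<pi>"
  using code by (simp add: factor_code_def)

lemma continuous_map_shift: "continuous_map (shift_top X) (shift_top X) shift_map"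
  using homeomorphic_maps_shift[OF shift_spaces(1)] by (simp add: homeomorphic_maps_def)

text \<open>Two almost sure constant values must agree on a set of full measure, which is nonempty
  in a probability space.\<close>

lemma quadruple_degree_eq:
  assumes \<nu>: "prob_space \<nu>" and dt: "AE y in \<nu>. doubly_transitive Y y"
  shows "quadruple_degree (shift_top X) \<pi> \<nu> = enat degree"
proof -
  have ae: "AE y in \<nu>. ecard (fiber X \<pi> y) = enat degree"
    using dt
  proof eventually_elim
    case (elim y)
    then have "finite (fiber X \<pi> y)"
      using finite_fiber by (simp add: doubly_transitive_def)
    then show ?case using card_fiber_eq_code_degree[OF elim] by (simp add: ecard_def)
  qed
  have "c = enat degree" if "AE y in \<nu>. ecard (fiber X \<pi> y) = c" for c
  proof -
    have "AE y in \<nu>. c = enat degree" using ae that by eventually_elim simp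
    then show ?thesis by (simp add: prob_space.AE_const[OF \<nu>])
  qed
  with ae show ?thesis
    unfolding quadruple_degree_def topspace_shift_top by (intro the_equality)
qed

text \<open>Some doubly transitive point exists, and its fiber is finite and nonempty. Positivity
  makes the index \<open>1\<close> available for marginals.\<close>

lemma degree_pos:
  assumes \<nu>: "prob_space \<nu>" and dt: "AE y in \<nu>. doubly_transitive Y y"
  shows "degree > 0"
proof -
  obtain y where y: "doubly_transitive Y y"
    using dt prob_space.AE_False[OF \<nu>] by (metis (mono_tags, lifting) eventually_mono)
  then have "y \<in> Y" by (simp add: doubly_transitive_def)
  then show ?thesis
    using card_fiber_eq_code_degree[OF y] fiber_nonempty finite_fiber
    by (metis card_gt_0_iff)
qed

text \<open>Both sides are the image of \<mu> under \<open>z \<mapsto> \<pi> (z i)\<close>; it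
  suffices that \<open>p\<close> agrees with this map on \<open>L\<close>, where \<mu>
  lives.\<close>

lemma distr_push_inclusion:
  assumes \<mu>: "\<mu> \<in> ergodic_measures (subtopology (power_top n (shift_top X)) L) f"
    and i: "i \<in> {1..n}" and L: "L \<subseteq> {1..n} \<rightarrow>\<^sub>E X" and p: "\<forall>z\<in>L. p z = \<pi> (z i)"
  shows "distr (distr (push_inclusion (power_top n (shift_top X)) \<mu>) (borel_of (shift_top X)) (\<lambda>z. z i))
      (borel_of (shift_top Y)) \<pi> = distr \<mu> (borel_of (shift_top Y)) p"
proof -
  note D = ergodic_measuresD[OF \<mu>]
  note m = inclusion_measurable[OF D(2)] continuous_map_measurable[OF continuous_map_code]
    continuous_map_measurable[OF continuous_map_power_projection[OF i, of "shift_top X"]]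
  show ?thesis
    unfolding push_inclusion_def distr_distr[OF m(3) m(1)]
    using measurable_comp[OF m(1) m(3)]
    by (subst distr_distr[OF m(2)]) (auto intro!: distr_cong simp: D(3) p)
qed

text \<open>The marginals of a degree joining force its base point to be doubly transitive almost
  surely, so distinct coordinates are mutually separated and \<Lambda> has full measure. Conversely,
  points of \<Lambda> satisfy the fiber and distinctness conditions outright, and \<open>p\<close>
  determines every marginal.\<close>

lemma degree_joinings_eq:
  fixes p
  defines "T \<equiv> power_top degree (shift_top X)"
  assumes \<nu>: "\<nu> \<in> ergodic_measures (shift_top Y) shift_map"
    and supp: "fully_supported (shift_top Y) \<nu>"
    and p: "\<And>z i. z \<in> \<Lambda> \<Longrightarrow> i \<in> {1..degree} \<Longrightarrow> p z = \<pi> (z i)"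
  shows "degree_joinings (shift_top X) shift_map (shift_top Y) \<pi> \<nu> = push_inclusion T `
    {\<mu> \<in> ergodic_measures (subtopology T \<Lambda>) (power_map degree shift_map).
       distr \<mu> (borel_of (shift_top Y)) p = \<nu>}" (is "?J = ?I")
proof
  have prob: "prob_space \<nu>" using ergodic_measuresD(1)[OF \<nu>] .
  have dt: "AE y in \<nu>. doubly_transitive Y y"
    using AE_doubly_transitive[OF shift_spaces(2) \<nu> supp] .
  have deg: "quadruple_degree (shift_top X) \<pi> \<nu> = enat degree"
    using quadruple_degree_eq[OF prob dt] .
  have one: "1 \<in> {1..degree}" using degree_pos[OF prob dt] by simp
  have inv: "\<forall>z\<in>topspace T. power_map degree shift_map z \<in> \<Lambda> \<longleftrightarrow> z \<in> \<Lambda>"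
    using power_map_degree_joining_iff by (simp add: T_def)
  have L: "\<Lambda> \<in> sets (borel_of T)" unfolding T_def by (rule degree_joining_in_sets)
  have LX: "\<Lambda> \<subseteq> {1..degree} \<rightarrow>\<^sub>E X" by (auto simp: degree_joining_eq)
  note push = distr_push_inclusion[OF _ _ LX, folded T_def]
  show "?J \<subseteq> ?I"
  proof
    fix \<rho> assume "\<rho> \<in> ?J"
    then have erg: "\<rho> \<in> ergodic_measures T (power_map degree shift_map)"
      and fp: "emeasure \<rho> (fiber_power degree X \<pi>) = 1"
      and marg: "\<And>i. i \<in> {1..degree} \<Longrightarrow>
        distr (distr \<rho> (borel_of (shift_top X)) (\<lambda>z. z i)) (borel_of (shift_top Y)) \<pi> = \<nu>"
      and dist: "AE z in \<rho>. inj_on z {1..degree}"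
      unfolding degree_joinings_def deg T_def by auto
    have "AE z in \<rho>. z \<in> fiber_power degree X \<pi>"
      using prob_space.AE_prob_1[OF ergodic_measuresD(1)[OF erg]] fp by (simp add: measure_def)
    \<comment> \<open>The first marginal projects to \<nu>, so an almost sure property of \<nu>
      pulls back along \<open>z \<mapsto> \<pi> (z 1)\<close>.\<close>
    moreover have "AE z in \<rho>. doubly_transitive Y (\<pi> (z 1))"
    proof -
      let ?\<sigma> = "distr \<rho> (borel_of (shift_top X)) (\<lambda>z. z 1)"
      have 1: "(\<lambda>z. z 1) \<in> measurable \<rho> (borel_of (shift_top X))"
        using ergodic_measurable_from[OF erg] continuous_map_power_projection[OF one]
        unfolding T_def by blast
      have 2: "\<pi> \<in> measurable ?\<sigma> (borel_of (shift_top Y))"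
        using continuous_map_measurable[OF continuous_map_code] by simp
      have "AE y in distr ?\<sigma> (borel_of (shift_top Y)) \<pi>. doubly_transitive Y y"
        by (simp only: marg[OF one] dt)
      from AE_distrD[OF 1 AE_distrD[OF 2 this]] show ?thesis .
    qed
    ultimately have full: "AE z in \<rho>. z \<in> \<Lambda>"
      using dist
    proof eventually_elim
      case (elim z)
      have "z i \<in> fiber X \<pi> (\<pi> (z 1))" if "i \<in> {1..degree}" for i
      proof -
        have "z \<in> {1..degree} \<rightarrow>\<^sub>E X" "\<pi> (z i) = \<pi> (z 1)"
          using elim(1) that one unfolding fiber_power_def by blast+
        then show ?thesis using PiE_mem[OF _ that] by (simp add: fiber_def)
      qed
      then have "pairwise mutually_separated (z ` {1..degree})"
        using fiber_mutually_separated[OF elim(2)] by (auto simp: pairwise_def)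
      then show ?case using elim by (simp add: topological_degree_joining_def Let_def)
    qed
    let ?\<mu> = "restrict_space \<rho> \<Lambda>"
    note R = ergodic_restrict_space[OF erg L inv full]
    \<comment> \<open>Pushing the restriction back recovers \<rho>, and on \<Lambda> the map
      \<open>p\<close> is the first projection followed by \<pi>, so the first marginal of \<rho>
      gives the claim.\<close>
    have "distr ?\<mu> (borel_of (shift_top Y)) p = \<nu>"
      using push[OF R(1) one, of p] p[OF _ one] marg[OF one] by (simp add: R(2))
    then show "\<rho> \<in> ?I" using R by (intro image_eqI[of _ _ ?\<mu>]) auto
  qed
  show "?I \<subseteq> ?J"
  proof safe
    fix \<mu> assume \<mu>: "\<mu> \<in> ergodic_measures (subtopology T \<Lambda>) (power_map degree shift_map)"
      and \<nu>_eq: "\<nu> = distr \<mu> (borel_of (shift_top Y)) p"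
    have "continuous_map T T (power_map degree shift_map)"
      unfolding T_def by (rule continuous_map_power_map[OF continuous_map_shift])
    note P = ergodic_push_inclusion[OF \<mu> L inv this]
    let ?\<rho> = "push_inclusion T \<mu>"
    have "emeasure ?\<rho> (fiber_power degree X \<pi>) = 1"
    proof (rule prob_space.emeasure_eq_1_AE[OF ergodic_measuresD(1)[OF P(1)]])
      show "fiber_power degree X \<pi> \<in> sets ?\<rho>"
        using fiber_power_in_sets ergodic_measuresD(2)[OF P(1)] by (simp add: T_def)
      show "AE z in ?\<rho>. z \<in> fiber_power degree X \<pi>"
        using P(2) by eventually_elim (simp add: topological_degree_joining_def Let_def)
    qed
    moreover have "AE z in ?\<rho>. inj_on z {1..degree}"
      using P(2) by eventually_elim (simp add: topological_degree_joining_def Let_def)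
    moreover have "\<forall>i\<in>{1..degree}.
        distr (distr ?\<rho> (borel_of (shift_top X)) (\<lambda>z. z i)) (borel_of (shift_top Y)) \<pi> = \<nu>"
      using push[OF \<mu>, of _ p] p \<nu>_eq by simp
    ultimately show "?\<rho> \<in> degree_joinings (shift_top X) shift_map (shift_top Y) \<pi>
        (distr \<mu> (borel_of (shift_top Y)) p)"
      using P(1) deg unfolding degree_joinings_def T_def \<nu>_eq by simp
  qed
qed

lemma factor_quadruple_code:
  assumes "\<nu> \<in> ergodic_measures (shift_top Y) shift_map"
  shows "factor_quadruple (shift_top X) shift_map (shift_top Y) shift_map \<pi> \<nu>"
  using assms code shift_spaces[THEN dynamical_system_shift] by (simp add: factor_quadruple_def factor_code_def)

end

theorem theorem7p10:
  fixes X :: "(int \<Rightarrow> 'a::finite) set" and Y :: "(int \<Rightarrow> 'b::finite) set"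
    and \<pi> :: "(int \<Rightarrow> 'a) \<Rightarrow> (int \<Rightarrow> 'b)" and d :: nat
    and \<Lambda> :: "(nat \<Rightarrow> int \<Rightarrow> 'a) set" and \<pi>\<^sub>\<Lambda> :: "(nat \<Rightarrow> int \<Rightarrow> 'a) \<Rightarrow> (int \<Rightarrow> 'b)"
  assumes "one_step_SFT X" and "irreducible_shift X"
    and "factor_code X Y \<pi>" and "one_block X \<pi>" and "finite_to_one X Y \<pi>"
    and "code_degree X Y \<pi> = d"
    and "\<Lambda> = topological_degree_joining X Y \<pi>"
    and "\<And>z i. z \<in> \<Lambda> \<Longrightarrow> i \<in> {1..d} \<Longrightarrow> \<pi>\<^sub>\<Lambda> z = \<pi> (z i)"
    and "\<nu> \<in> ergodic_measures (shift_top Y) shift_map" and "fully_supported (shift_top Y) \<nu>"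
  shows "factor_quadruple (shift_top X) shift_map (shift_top Y) shift_map \<pi> \<nu>
    \<and> quadruple_degree (shift_top X) \<pi> \<nu> = enat d
    \<and> degree_joinings (shift_top X) shift_map (shift_top Y) \<pi> \<nu> =
        push_inclusion (power_top d (shift_top X)) `
          {\<mu> \<in> ergodic_measures (subtopology (power_top d (shift_top X)) \<Lambda>) (power_map d shift_map).
             distr \<mu> (borel_of (shift_top Y)) \<pi>\<^sub>\<Lambda> = \<nu>}"
proof -
  interpret one_block_code X Y \<pi>
    by unfold_locales (fact assms)+
  note \<nu> = \<open>\<nu> \<in> ergodic_measures (shift_top Y) shift_map\<close>
    and supp = \<open>fully_supported (shift_top Y) \<nu>\<close>
  have p: "\<pi>\<^sub>\<Lambda> z = \<pi> (z i)" if "z \<in> topological_degree_joining X Y \<pi>" "i \<in> {1..code_degree X Y \<pi>}" for z i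
    using assms(6-8) that by simp
  have "quadruple_degree (shift_top X) \<pi> \<nu> = enat d"
    using quadruple_degree_eq[OF ergodic_measuresD(1)[OF \<nu>] AE_doubly_transitive[OF shift_spaces(2) \<nu> supp]]
      assms(6) by simp
  with factor_quadruple_code[OF \<nu>] degree_joinings_eq[OF \<nu> supp p] show ?thesis
    by (simp only: assms(6,7))
qed

end
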